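(* Let $G$ be a finite group and let $W=\bigoplus_{g\in G}W_g$ be an associative $G$-graded twisted $\mathbb{R}$-algebra. Then there are finitely many division rings $D_1,\dots,D_r$, each equal to one of $\mathbb{R}$, $\mathbb{C}$ or $\mathbb{H}$ (the quaternions), and finite-dimensional vector spaces $V_i$ over $D_i$ ($1\le i\le r$) such that $W$ is isomorphic as an $\mathbb{R}$-algebra to the direct sum $\bigoplus_{i=1}^r \mathrm{Hom}_{D_i}(V_i,V_i)$.
   Context: A $G$-graded twisted $\mathbb{R}$-algebra is an $\mathbb{R}$-algebra $W$ with a grading $W=\bigoplus_{g\in G}W_g$, $W_aW_b\subset W_{ab}$, such that each $W_g$ is one-dimensional over $\mathbb{R}$, $w_aw_b\neq 0$ for all nonzero $w_a\in W_a$, $w_b\in W_b$ (all $a,b\in G$), and $W$ has an identity element $1\in W_e$, where $e$ is the identity of $G$. *)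

theory Defs
  imports "HOL-Analysis.Analysis" "HOL-Algebra.QuotRing" "HOL-Algebra.Module"
begin

datatype quat = Quat (q0: real) (q1: real) (q2: real) (q3: real)

instantiation quat :: real_div_algebra
begin

definition "0 = Quat 0 0 0 0"
definition "1 = Quat 1 0 0 0"
definition "x + y = Quat (q0 x + q0 y) (q1 x + q1 y) (q2 x + q2 y) (q3 x + q3 y)"
definition "- x = Quat (- q0 x) (- q1 x) (- q2 x) (- q3 x)"
definition "x - y = Quat (q0 x - q0 y) (q1 x - q1 y) (q2 x - q2 y) (q3 x - q3 y)"
definition "a *\<^sub>R x = Quat (a * q0 x) (a * q1 x) (a * q2 x) (a * q3 x)"
definition "x * y = Quat
  (q0 x * q0 y - q1 x * q1 y - q2 x * q2 y - q3 x * q3 y)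
  (q0 x * q1 y + q1 x * q0 y + q2 x * q3 y - q3 x * q2 y)
  (q0 x * q2 y - q1 x * q3 y + q2 x * q0 y + q3 x * q1 y)
  (q0 x * q3 y + q1 x * q2 y - q2 x * q1 y + q3 x * q0 y)"
definition "inverse x =
  (1 / ((q0 x)\<^sup>2 + (q1 x)\<^sup>2 + (q2 x)\<^sup>2 + (q3 x)\<^sup>2)) *\<^sub>R Quat (q0 x) (- q1 x) (- q2 x) (- q3 x)"
definition "x div y = x * inverse (y :: quat)"

lemmas quat_defs = zero_quat_def one_quat_def plus_quat_def uminus_quat_def minus_quat_def
  scaleR_quat_def times_quat_def inverse_quat_def divide_quat_def

lemma quat_norm_pos:
  assumes "x \<noteq> 0"
  shows "(q0 x)\<^sup>2 + (q1 x)\<^sup>2 + (q2 x)\<^sup>2 + (q3 x)\<^sup>2 > 0"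
proof -
  from assms have "q0 x \<noteq> 0 \<or> q1 x \<noteq> 0 \<or> q2 x \<noteq> 0 \<or> q3 x \<noteq> 0"
    by (cases x) (simp add: zero_quat_def)
  then show ?thesis
    by (metis add_nonneg_pos add_pos_nonneg sum_power2_gt_zero_iff zero_le_power2
        add_nonneg_nonneg zero_less_power2)
qed

instance
proof
  fix x :: quat
  assume "x \<noteq> 0"
  from quat_norm_pos[OF this]
  have nz: "(q0 x)\<^sup>2 + (q1 x)\<^sup>2 + (q2 x)\<^sup>2 + (q3 x)\<^sup>2 \<noteq> 0" by simp
  then show "inverse x * x = 1" "x * inverse x = 1"
    by (simp_all add: quat_defs add_divide_distrib[symmetric] diff_divide_distrib[symmetric]
        power2_eq_square algebra_simps)
qed (auto simp: quat_defs algebra_simps)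

end

definition quat_of_complex :: "complex \<Rightarrow> quat" where
  "quat_of_complex z = Quat (Re z) (Im z) 0 0"

locale skew_field = ring R for R (structure) +
  assumes skew_field_Units: "Units R = carrier R - {\<zero>}"

text \<open>The library's \<open>module\<close> locale requires a commutative ring of scalars.\<close>

locale left_vector_space = D?: skew_field D + V?: abelian_group V
  for D :: "('d, 'l) ring_scheme" (structure) and V :: "('d, 'v, 'k) module_scheme" (structure) +
  assumes smult_closed:
      "\<lbrakk>a \<in> carrier D; x \<in> carrier V\<rbrakk> \<Longrightarrow> a \<odot>\<^bsub>V\<^esub> x \<in> carrier V"
    and smult_l_distr:
      "\<lbrakk>a \<in> carrier D; b \<in> carrier D; x \<in> carrier V\<rbrakk> \<Longrightarrow>
      (a \<oplus>\<^bsub>D\<^esub> b) \<odot>\<^bsub>V\<^esub> x = a \<odot>\<^bsub>V\<^esub> x \<oplus>\<^bsub>V\<^esub> b \<odot>\<^bsub>V\<^esub> x"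
    and smult_r_distr:
      "\<lbrakk>a \<in> carrier D; x \<in> carrier V; y \<in> carrier V\<rbrakk> \<Longrightarrow>
      a \<odot>\<^bsub>V\<^esub> (x \<oplus>\<^bsub>V\<^esub> y) = a \<odot>\<^bsub>V\<^esub> x \<oplus>\<^bsub>V\<^esub> a \<odot>\<^bsub>V\<^esub> y"
    and smult_assoc:
      "\<lbrakk>a \<in> carrier D; b \<in> carrier D; x \<in> carrier V\<rbrakk> \<Longrightarrow>
      (a \<otimes>\<^bsub>D\<^esub> b) \<odot>\<^bsub>V\<^esub> x = a \<odot>\<^bsub>V\<^esub> (b \<odot>\<^bsub>V\<^esub> x)"
    and smult_one: "x \<in> carrier V \<Longrightarrow> \<one>\<^bsub>D\<^esub> \<odot>\<^bsub>V\<^esub> x = x"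

locale fin_dim_vector_space = left_vector_space +
  assumes finitely_spanned:
    "\<exists>B. finite B \<and> B \<subseteq> carrier V \<and>
      (\<forall>v\<in>carrier V. \<exists>c\<in>B \<rightarrow> carrier D. v = (\<Oplus>\<^bsub>V\<^esub>b\<in>B. c b \<odot>\<^bsub>V\<^esub> b))"

text \<open>
  The three real division algebras as rings with carriers in the common type \<^typ>\<open>quat\<close>, so
  that a family of them can be quantified over; the isomorphisms with \<^typ>\<open>real\<close> and
  \<^typ>\<open>complex\<close> are proved below.
\<close>

definition ring_on :: "'a::ring_1 set \<Rightarrow> 'a ring" where
  "ring_on S = \<lparr>carrier = S, mult = (*), one = 1, zero = 0, add = (+)\<rparr>"

definition R_ring :: "quat ring" where "R_ring = ring_on (range of_real)"
definition C_ring :: "quat ring" where "C_ring = ring_on (range quat_of_complex)"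
definition H_ring :: "quat ring" where "H_ring = ring_on UNIV"

text \<open>
  Real algebras with an explicit carrier are represented by the record type
  \<^typ>\<open>(real, 'a) module\<close>, which has ring operations and a scalar multiplication.
\<close>

definition type_algebra :: "(real, 'w::real_algebra_1) module" where
  "type_algebra =
    \<lparr>carrier = UNIV, mult = (*), one = 1, zero = 0, add = (+), smult = scaleR\<rparr>"

definition real_algebra_iso ::
    "(real, 'a, 'm) module_scheme \<Rightarrow> (real, 'b, 'n) module_scheme \<Rightarrow> ('a \<Rightarrow> 'b) set" where
  "real_algebra_iso A B = {\<phi> \<in> ring_iso A B.
     \<forall>a. \<forall>x\<in>carrier A. \<phi> (a \<odot>\<^bsub>A\<^esub> x) = a \<odot>\<^bsub>B\<^esub> \<phi> x}"

text \<open>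
  \<open>Hom\<^sub>D(V,V)\<close>. Maps are undefined outside the carrier of \<open>V\<close>, so that equality of
  functions is equality of endomorphisms.
\<close>

definition End_algebra ::
    "('d::real_algebra_1, 'l) ring_scheme \<Rightarrow> ('d, 'v, 'k) module_scheme \<Rightarrow> (real, 'v \<Rightarrow> 'v) module"
  where
  "End_algebra D V =
    \<lparr>carrier = {f \<in> carrier V \<rightarrow>\<^sub>E carrier V.
        (\<forall>x\<in>carrier V. \<forall>y\<in>carrier V. f (x \<oplus>\<^bsub>V\<^esub> y) = f x \<oplus>\<^bsub>V\<^esub> f y) \<and>
        (\<forall>d\<in>carrier D. \<forall>x\<in>carrier V. f (d \<odot>\<^bsub>V\<^esub> x) = d \<odot>\<^bsub>V\<^esub> f x)},
     mult = compose (carrier V),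
     one = (\<lambda>x\<in>carrier V. x),
     zero = (\<lambda>x\<in>carrier V. \<zero>\<^bsub>V\<^esub>),
     add = (\<lambda>f g. \<lambda>x\<in>carrier V. f x \<oplus>\<^bsub>V\<^esub> g x),
     smult = (\<lambda>a f. \<lambda>x\<in>carrier V. of_real a \<odot>\<^bsub>V\<^esub> f x)\<rparr>"

definition algebra_direct_sum ::
    "nat \<Rightarrow> (nat \<Rightarrow> (real, 'a, 'm) module_scheme) \<Rightarrow> (real, nat \<Rightarrow> 'a) module" where
  "algebra_direct_sum r A =
    \<lparr>carrier = (\<Pi>\<^sub>E i\<in>{..<r}. carrier (A i)),
     mult = (\<lambda>x y. \<lambda>i\<in>{..<r}. x i \<otimes>\<^bsub>A i\<^esub> y i),
     one = (\<lambda>i\<in>{..<r}. \<one>\<^bsub>A i\<^esub>),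
     zero = (\<lambda>i\<in>{..<r}. \<zero>\<^bsub>A i\<^esub>),
     add = (\<lambda>x y. \<lambda>i\<in>{..<r}. x i \<oplus>\<^bsub>A i\<^esub> y i),
     smult = (\<lambda>a x. \<lambda>i\<in>{..<r}. a \<odot>\<^bsub>A i\<^esub> x i)\<rparr>"

text \<open>
  The multiplication is an arbitrary bilinear map; associativity is not part of the notion.
\<close>

definition direct_sum_decomposition :: "'g set \<Rightarrow> ('g \<Rightarrow> 'w::real_vector set) \<Rightarrow> bool" where
  "direct_sum_decomposition I W \<longleftrightarrow>
    (\<forall>g\<in>I. subspace (W g)) \<and>
    (\<forall>x. \<exists>!c. (\<forall>g\<in>I. c g \<in> W g) \<and> (\<forall>g. g \<notin> I \<longrightarrow> c g = 0) \<and>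
       finite {g. c g \<noteq> 0} \<and> x = (\<Sum>g | c g \<noteq> 0. c g))"

locale graded_twisted_algebra = group G
  for G :: "('g, 'm) monoid_scheme" (structure) +
  fixes W :: "'g \<Rightarrow> 'w::real_vector set"
    and mul :: "'w \<Rightarrow> 'w \<Rightarrow> 'w"
    and unit :: 'w
  assumes mul_bilinear: "bilinear mul"
    and mul_unit: "mul unit x = x" "mul x unit = x"
    and grading: "direct_sum_decomposition (carrier G) W"
    and mul_graded: "\<lbrakk>a \<in> carrier G; b \<in> carrier G; x \<in> W a; y \<in> W b\<rbrakk> \<Longrightarrow> mul x y \<in> W (a \<otimes> b)"
    and one_dimensional: "a \<in> carrier G \<Longrightarrow> dim (W a) = 1"
    and mul_nonzero:
      "\<lbrakk>a \<in> carrier G; b \<in> carrier G; x \<in> W a; y \<in> W b; x \<noteq> 0; y \<noteq> 0\<rbrakk> \<Longrightarrow> mul x y \<noteq> 0"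
    and unit_degree: "unit \<in> W \<one>"

lemma of_real_quat: "of_real a = Quat a 0 0 0"
  by (simp add: of_real_def quat_defs)

lemma R_ring_iso: "of_real \<in> ring_iso (ring_on (UNIV :: real set)) R_ring"
  by (auto simp: ring_iso_def ring_hom_def R_ring_def ring_on_def bij_betw_def inj_on_def)

lemma C_ring_iso: "quat_of_complex \<in> ring_iso (ring_on (UNIV :: complex set)) C_ring"
  by (auto simp: ring_iso_def ring_hom_def C_ring_def ring_on_def bij_betw_def inj_on_def
      quat_of_complex_def quat_defs complex_eq_iff)

lemma quat_of_complex_of_real: "quat_of_complex (of_real a) = of_real a"
  by (simp add: of_real_quat quat_of_complex_def)

lemma skew_field_ring_on:
  fixes S :: "'a::division_ring set"
  assumes "0 \<in> S" "1 \<in> S" "\<And>x y. x \<in> S \<Longrightarrow> y \<in> S \<Longrightarrow> x + y \<in> S"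
    "\<And>x y. x \<in> S \<Longrightarrow> y \<in> S \<Longrightarrow> x * y \<in> S" "\<And>x. x \<in> S \<Longrightarrow> - x \<in> S"
    "\<And>x. x \<in> S \<Longrightarrow> inverse x \<in> S"
  shows "skew_field (ring_on S)"
proof -
  interpret ring "ring_on S"
  proof (rule ringI)
    show "abelian_group (ring_on S)"
    proof (rule abelian_groupI)
      show "\<exists>y\<in>carrier (ring_on S). y \<oplus>\<^bsub>ring_on S\<^esub> x = \<zero>\<^bsub>ring_on S\<^esub>"
        if "x \<in> carrier (ring_on S)" for x
        using that assms(5) by (intro bexI[of _ "- x"]) (auto simp: ring_on_def)
    qed (use assms in \<open>auto simp: ring_on_def algebra_simps\<close>)
    show "monoid (ring_on S)"
      by (rule monoidI) (use assms in \<open>auto simp: ring_on_def algebra_simps\<close>)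
  qed (auto simp: ring_on_def algebra_simps)
  show ?thesis
  proof
    show "Units (ring_on S) = carrier (ring_on S) - {\<zero>\<^bsub>ring_on S\<^esub>}"
    proof
      show "Units (ring_on S) \<subseteq> carrier (ring_on S) - {\<zero>\<^bsub>ring_on S\<^esub>}"
        by (auto simp: Units_def ring_on_def)
      show "carrier (ring_on S) - {\<zero>\<^bsub>ring_on S\<^esub>} \<subseteq> Units (ring_on S)"
      proof
        fix x assume "x \<in> carrier (ring_on S) - {\<zero>\<^bsub>ring_on S\<^esub>}"
        then have "x \<in> S" "x \<noteq> 0" by (auto simp: ring_on_def)
        then show "x \<in> Units (ring_on S)"
          using assms(6)[of x] by (auto simp: Units_def ring_on_def intro!: bexI[of _ "inverse x"])
      qed
    qed
  qed
qed

lemma skew_field_R_ring: "skew_field R_ring"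
  unfolding R_ring_def
  by (rule skew_field_ring_on)
    (auto simp flip: of_real_add of_real_mult of_real_minus of_real_inverse
      intro: range_eqI[of _ _ 0] range_eqI[of _ _ 1])

lemma skew_field_C_ring: "skew_field C_ring"
proof -
  have "range quat_of_complex = {x. q2 x = 0 \<and> q3 x = 0}"
  proof (intro equalityI subsetI)
    fix x assume "x \<in> {x. q2 x = 0 \<and> q3 x = 0}"
    then have "x = quat_of_complex (Complex (q0 x) (q1 x))"
      by (cases x) (simp add: quat_of_complex_def)
    then show "x \<in> range quat_of_complex" by blast
  qed (auto simp: quat_of_complex_def)
  then show ?thesis
    unfolding C_ring_def by (intro skew_field_ring_on) (auto simp: quat_defs)
qed

lemma skew_field_H_ring: "skew_field H_ring"
  unfolding H_ring_def by (rule skew_field_ring_on) auto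

end

theory Submission
  imports Defs "HOL-Computational_Algebra.Fundamental_Theorem_Algebra"
begin

text \<open>
  Averaging a linear projection over the homogeneous components, as in Maschke's theorem, shows
  that every left ideal of \<open>W\<close> has a complement, so every nonzero left ideal contains an
  idempotent \<open>e\<close> for which \<open>We\<close> is minimal. A maximal family of such idempotents with \<open>eWf = 0\<close>
  for \<open>e \<noteq> f\<close> satisfies \<open>\<Sum>\<^sub>e WeW = W\<close>: a complement of this sum would contain a further member.
  Writing \<open>1\<close> as an element of \<open>\<Sum>\<^sub>e WeW\<close> shows that \<open>W\<close> acts faithfully on the right
  \<open>eWe\<close>-spaces \<open>We\<close>, and that every family of \<open>eWe\<close>-linear endomorphisms is a left multiplication.
  Each \<open>eWe\<close> is a division algebra, hence \<open>\<real>\<close>, \<open>\<complex>\<close> or the quaternions by Frobenius' theorem; all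
  three are isomorphic to their opposites, which turns right spaces into left ones.
\<close>

section \<open>Real division algebras of finite dimension\<close>

text \<open>Horner evaluation of a real polynomial at an algebra element, with \<open>e\<close> in
  the place of 1. It will be used inside corners eAe, whose unit is \<open>e\<close>, and whose
  elements need not commute with each other.\<close>

definition peval :: "'a::real_algebra \<Rightarrow> real poly \<Rightarrow> 'a \<Rightarrow> 'a" where
  "peval e p x = fold_coeffs (\<lambda>a y. a *\<^sub>R e + x * y) p 0"

lemma peval_0 [simp]: "peval e 0 x = 0"
  by (simp add: peval_def)

lemma peval_pCons [simp]: "peval e (pCons a p) x = a *\<^sub>R e + x * peval e p x"
  by (cases "p = 0 \<and> a = 0") (auto simp: peval_def)

lemma peval_add: "peval e (p + q) x = peval e p x + peval e q x"
  by (induction p q rule: poly_induct2) (simp_all add: algebra_simps)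

lemma peval_smult: "peval e (Polynomial.smult a p) x = a *\<^sub>R peval e p x"
  by (induction p) (simp_all add: algebra_simps)

text \<open>By induction on \<open>p\<close>: each step multiplies by \<open>x\<close> on the left,
  and \<open>e\<close> acts as a left unit on every value of \<open>peval\<close>.\<close>

lemma peval_mult:
  assumes "e * e = e" "e * x = x"
  shows "peval e (p * q) x = peval e p x * peval e q x"
proof -
  have e: "e * peval e q x = peval e q x"
    by (induction q) (simp_all add: assms distrib_left flip: mult.assoc)
  show ?thesis
    by (induction p) (simp_all add: peval_add peval_smult distrib_right e mult.assoc)
qed

lemma peval_monom: "peval e (monom a n) x = a *\<^sub>R ((*) x ^^ n) e"
  by (induction n) (simp_all add: monom_0 monom_Suc)

lemma peval_sum: "peval e (\<Sum>n\<in>A. p n) x = (\<Sum>n\<in>A. peval e (p n) x)"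
  by (induction A rule: infinite_finite_induct) (simp_all add: peval_add)

lemma peval_complex: "peval 1 p z = poly (map_poly complex_of_real p) z"
  by (induction p) (simp_all add: map_poly_pCons scaleR_conv_of_real)

text \<open>A complex root \<open>z\<close> exists, and its minimal polynomial over the reals is a
  factor. The bound on the degree of \<open>r\<close> serves the induction in
  \<open>quadratic\<close>.\<close>

lemma real_poly_linear_or_quadratic_factor:
  fixes p :: "real poly"
  assumes "degree p > 0"
  obtains q r where "p = q * r" "r \<noteq> 0" "degree r < degree p"
    "(\<exists>a. q = [:a, 1:]) \<or> (\<exists>a b. q = [:a, b, 1:])"
proof -
  have deg: "degree (map_poly complex_of_real p) = degree p"
    by (simp add: degree_map_poly)
  have "\<not> constant (poly (map_poly complex_of_real p))"
    using assms deg by (simp add: constant_degree)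
  then obtain z where "poly (map_poly complex_of_real p) z = 0"
    using fundamental_theorem_of_algebra by blast
  then have z: "peval 1 p z = 0"
    by (simp add: peval_complex)
  \<comment> \<open>This is the minimal polynomial of \<open>z\<close>: X - z for real
    \<open>z\<close>, otherwise (X - z) times (X - conjugate of z).\<close>
  define q where "q = (if Im z = 0 then [:- Re z, 1:] else [:(Re z)\<^sup>2 + (Im z)\<^sup>2, - 2 * Re z, 1:])"
  have q: "peval 1 q z = 0" "q \<noteq> 0" "degree q > 0"
  proof -
    show "peval 1 q z = 0"
    proof (cases "Im z = 0")
      case True
      then show ?thesis by (simp add: q_def complex_eq_iff)
    next
      case False
      then show ?thesis by (simp add: q_def complex_eq_iff power2_eq_square)
    qed
  qed (simp_all add: q_def)
  have "p = q * (p div q) + p mod q" by simp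
  from arg_cong[OF this, of "\<lambda>p. peval 1 p z"]
  have "peval 1 p z = peval 1 q z * peval 1 (p div q) z + peval 1 (p mod q) z"
    by (simp only: peval_add peval_mult mult_1)
  then have m: "peval 1 (p mod q) z = 0"
    using z q by simp
  have "p mod q = 0"
  proof (rule ccontr)
    assume nz: "p mod q \<noteq> 0"
    then have d: "degree (p mod q) < degree q"
      using degree_mod_less[OF q(2)] by blast
    \<comment> \<open>The remainder has the form u + vX and vanishes at \<open>z\<close>. For
      non-real \<open>z\<close> the imaginary part of its value forces v = 0; for real
      \<open>z\<close> the degree does. Then u = 0 as well.\<close>
    obtain u v where uv: "p mod q = [:u, v:]" "Im z = 0 \<Longrightarrow> v = 0"
    proof (cases "Im z = 0")
      case True
      then have "degree (p mod q) = 0" using d by (simp add: q_def)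
      then show thesis using that by (metis degree_eq_zeroE pCons_0_0)
    next
      case False
      then have "degree (p mod q) < 2" using d by (simp add: q_def)
      then have "p mod q = [:coeff (p mod q) 0, coeff (p mod q) 1:]"
        by (intro poly_eqI) (auto simp: coeff_pCons coeff_eq_0 split: nat.splits)
      then show thesis using that False by blast
    qed
    then have "u + v * Re z = 0" "v * Im z = 0"
      using m by (auto simp: complex_eq_iff)
    then have "u = 0 \<and> v = 0"
      using uv(2) by auto
    with uv nz show False by simp
  qed
  then have p: "p = q * (p div q)"
    by (simp add: mult.commute[of q] mod_eq_0_iff_dvd)
  have "p \<noteq> 0" using assms by auto
  then have nz: "p div q \<noteq> 0" using p by (metis mult_zero_right)
  have "degree p = degree q + degree (p div q)"
    by (subst p) (rule degree_mult_eq[OF q(2) nz])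
  with q(3) have "degree (p div q) < degree p" by simp
  then show thesis
    using that[OF p nz] by (auto simp: q_def split: if_splits)
qed

section \<open>Frobenius' theorem for subalgebras with their own unit\<close>

text \<open>The unit \<open>e\<close> of \<open>S\<close> need not be a unit of the ambient algebra,
  because the intended instances are the corners eAe.\<close>

locale real_division_subalgebra =
  fixes S :: "'a::real_algebra set" and e :: 'a
  assumes subspace: "subspace S"
    and mult_closed: "\<lbrakk>x \<in> S; y \<in> S\<rbrakk> \<Longrightarrow> x * y \<in> S"
    and unit_closed: "e \<in> S" and unit_nonzero: "e \<noteq> 0"
    and unit_left: "x \<in> S \<Longrightarrow> e * x = x"
    and unit_right: "x \<in> S \<Longrightarrow> x * e = x"
    and left_inverse: "\<lbrakk>x \<in> S; x \<noteq> 0\<rbrakk> \<Longrightarrow> \<exists>y\<in>S. y * x = e"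
    and finite_dimensional: "\<exists>B. finite B \<and> S \<subseteq> span B"
begin

lemmas closed = mult_closed unit_closed subspace_add[OF subspace] subspace_diff[OF subspace]
  subspace_scale[OF subspace] subspace_0[OF subspace] subspace_neg[OF subspace]

lemma no_zero_divisors:
  assumes "x \<in> S" "y \<in> S" "x * y = 0"
  shows "x = 0 \<or> y = 0"
proof (rule disjCI)
  assume "y \<noteq> 0"
  show "x = 0"
  proof (rule ccontr)
    assume "x \<noteq> 0"
    then obtain z where "z * x = e"
      using left_inverse assms by blast
    then have "y = z * (x * y)"
      using unit_left[OF assms(2)] by (simp flip: mult.assoc)
    with assms \<open>y \<noteq> 0\<close> show False by simp
  qed
qed

lemma peval_closed: "x \<in> S \<Longrightarrow> peval e p x \<in> S"
  by (induction p) (simp_all add: closed)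

text \<open>The \<open>card B + 1\<close> powers of \<open>x\<close> from exponent 0 to
  \<open>card B\<close> lie in a space spanned by \<open>card B\<close> vectors, so they satisfy a
  linear relation.\<close>

lemma annihilating_polynomial:
  assumes "x \<in> S"
  obtains p where "p \<noteq> 0" "peval e p x = 0"
proof -
  obtain B where B: "finite B" "S \<subseteq> span B"
    using finite_dimensional by blast
  define u where "u n = ((*) x ^^ n) e" for n
  have uS: "u n \<in> S" for n
    by (induction n) (simp_all add: u_def assms closed)
  obtain N c where c: "finite N" "(\<Sum>n\<in>N. c n *\<^sub>R u n) = 0" "\<exists>n\<in>N. c n \<noteq> 0"
  proof (cases "inj_on u {..card B}")
    case True
    have "u ` {..card B} \<subseteq> span B"
      using uS B by auto
    moreover have "card (u ` {..card B}) > card B"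
      using True by (simp add: card_image)
    ultimately have "dependent (u ` {..card B})"
      using real_vector.independent_span_bound[OF B(1)] leD by blast
    then obtain g where g: "\<exists>v\<in>u ` {..card B}. g v \<noteq> 0"
        "(\<Sum>v\<in>u ` {..card B}. g v *\<^sub>R v) = 0"
      using real_vector.dependent_finite[of "u ` {..card B}"] by auto
    then have "(\<Sum>n\<le>card B. g (u n) *\<^sub>R u n) = 0"
      using True by (simp add: sum.reindex)
    with g show thesis
      by (intro that[of "{..card B}" "g \<circ> u"]) auto
  next
    \<comment> \<open>A repeated power is invisible to dependence of the set of powers; here the
      difference of the two equal powers is the relation.\<close>
    case False
    then obtain m n where mn: "m \<noteq> n" "u m = u n"
      unfolding inj_on_def by blast
    then show thesis
      by (intro that[of "{m, n}" "\<lambda>k. if k = m then 1 else - 1"]) auto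
  qed
  define p where "p = (\<Sum>n\<in>N. monom (c n) n)"
  have "coeff p n = (if n \<in> N then c n else 0)" for n
    using c(1) by (simp add: p_def coeff_sum)
  then have "p \<noteq> 0"
    using c(3) by (metis coeff_0)
  moreover have "peval e p x = 0"
    using c(2) by (simp add: p_def peval_sum peval_monom u_def)
  ultimately show thesis by (rule that)
qed

text \<open>Split a linear or quadratic factor off an annihilating polynomial. Without zero
  divisors, either this factor or the cofactor of smaller degree annihilates \<open>x\<close>; the
  induction is on the degree.\<close>

lemma quadratic:
  assumes x: "x \<in> S"
  shows "\<exists>a b. x * x = a *\<^sub>R x + b *\<^sub>R e"
proof -
  have "\<exists>a b. x * x = a *\<^sub>R x + b *\<^sub>R e" if "p \<noteq> 0" "peval e p x = 0" for p
    using that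
  proof (induction "degree p" arbitrary: p rule: less_induct)
    case less
    have "degree p > 0"
    proof (rule ccontr)
      assume "\<not> degree p > 0"
      then obtain a where "p = [:a:]" by (metis degree_eq_zeroE gr0I)
      with less.prems unit_nonzero show False by simp
    qed
    then obtain q r where qr: "p = q * r" "r \<noteq> 0" "degree r < degree p"
        "(\<exists>a. q = [:a, 1:]) \<or> (\<exists>a b. q = [:a, b, 1:])"
      by (rule real_poly_linear_or_quadratic_factor)
    have "peval e q x * peval e r x = 0"
      using less.prems(2) x by (simp add: qr(1) peval_mult unit_left closed)
    then consider "peval e q x = 0" | "peval e r x = 0"
      using no_zero_divisors peval_closed x by blast
    then show ?case
    proof cases
      case 1
      from qr(4) show ?thesis
      proof (elim disjE exE)
        fix a assume "q = [:a, 1:]"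
        with 1 have "x = (- a) *\<^sub>R e"
          by (simp add: unit_right x eq_neg_iff_add_eq_0 add.commute)
        then have "x * x = (- a) *\<^sub>R x + 0 *\<^sub>R e"
          by (metis add.right_neutral mult_scaleR_left scaleR_zero_left unit_left x)
        then show ?thesis by blast
      next
        fix a b assume "q = [:a, b, 1:]"
        with 1 have "a *\<^sub>R e + (b *\<^sub>R x + x * x) = 0"
          by (simp add: unit_right x distrib_left)
        then have "x * x = (- b) *\<^sub>R x + (- a) *\<^sub>R e"
          by (simp add: algebra_simps eq_neg_iff_add_eq_0)
        then show ?thesis by blast
      qed
    next
      case 2
      then show ?thesis using less.hyps qr by blast
    qed
  qed
  then show ?thesis
    using annihilating_polynomial[OF x] by metis
qed

text \<open>\<open>x * x - c *\<^sub>R e\<close> factors over the reals as a product of two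
  commuting terms, one of which must vanish.\<close>

lemma square_real_nonneg:
  assumes x: "x \<in> S" and "x * x = c *\<^sub>R e" "c \<ge> 0"
  shows "x \<in> range (\<lambda>a. a *\<^sub>R e)"
proof -
  have "(x - sqrt c *\<^sub>R e) * (x + sqrt c *\<^sub>R e) = 0"
    using assms unit_left[OF x] unit_right[OF x] unit_left[OF unit_closed]
    by (simp add: algebra_simps)
  then have "x - sqrt c *\<^sub>R e = 0 \<or> x + sqrt c *\<^sub>R e = 0"
    using no_zero_divisors[of "x - sqrt c *\<^sub>R e" "x + sqrt c *\<^sub>R e"] x by (simp add: closed)
  then have "x = sqrt c *\<^sub>R e \<or> x = (- sqrt c) *\<^sub>R e"
    by (auto simp: eq_neg_iff_add_eq_0)
  then show ?thesis by blast
qed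

lemma imaginary_normalise:
  assumes x: "x \<in> S" "x \<notin> range (\<lambda>a. a *\<^sub>R e)" and "x * x = c *\<^sub>R e"
  obtains s where "s \<noteq> 0" "(s *\<^sub>R x) * (s *\<^sub>R x) = - e"
proof -
  have "c < 0"
    using square_real_nonneg assms by force
  then show thesis
    using assms by (intro that[of "1 / sqrt (- c)"]) (auto simp: field_simps)
qed

text \<open>Completing the square: if \<open>x * x = a *\<^sub>R x + b *\<^sub>R e\<close>, then
  \<open>x - (a / 2) *\<^sub>R e\<close> has a real square. It is negative because \<open>x\<close>
  is not real, so it can be scaled to \<open>- e\<close>.\<close>

lemma imaginary_part:
  assumes x: "x \<in> S" "x \<notin> range (\<lambda>a. a *\<^sub>R e)"
  obtains a s where "s \<noteq> 0" "(s *\<^sub>R (x - a *\<^sub>R e)) * (s *\<^sub>R (x - a *\<^sub>R e)) = - e"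
proof -
  obtain a b where "x * x = a *\<^sub>R x + b *\<^sub>R e"
    using quadratic x by blast
  then have "(x - (a / 2) *\<^sub>R e) * (x - (a / 2) *\<^sub>R e) = (b + a\<^sup>2 / 4) *\<^sub>R e"
    using unit_left[OF x(1)] unit_right[OF x(1)] unit_left[OF unit_closed]
    by (simp add: algebra_simps power2_eq_square flip: scaleR_add_left)
  moreover have "x - (a / 2) *\<^sub>R e \<notin> range (\<lambda>a. a *\<^sub>R e)"
  proof
    assume "x - (a / 2) *\<^sub>R e \<in> range (\<lambda>a. a *\<^sub>R e)"
    then obtain t where "x - (a / 2) *\<^sub>R e = t *\<^sub>R e" by blast
    then have "x = (t + a / 2) *\<^sub>R e" by (simp add: algebra_simps)
    then show False using x by blast
  qed
  moreover have "x - (a / 2) *\<^sub>R e \<in> S"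
    using x(1) by (simp add: closed)
  ultimately show thesis
    using imaginary_normalise that by blast
qed

text \<open>Reversing the product in the last coordinate makes this an antihomomorphism.\<close>

definition quat_span :: "'a \<Rightarrow> 'a \<Rightarrow> quat \<Rightarrow> 'a" where
  "quat_span i j q = q0 q *\<^sub>R e + q1 q *\<^sub>R i + q2 q *\<^sub>R j + q3 q *\<^sub>R (j * i)"

lemma linear_quat_span: "linear (quat_span i j)"
  by (rule linearI) (auto simp: quat_span_def quat_defs algebra_simps)

lemma quat_span_closed: "\<lbrakk>i \<in> S; j \<in> S\<rbrakk> \<Longrightarrow> quat_span i j q \<in> S"
  by (simp add: quat_span_def closed)

lemma quat_span_one: "quat_span i j 1 = e"
  by (simp add: quat_span_def quat_defs)

lemma quat_span_mult:
  assumes "i \<in> S" "j \<in> S" "i * i = - e" "j * j = - e" "i * j = - (j * i)"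
  shows "quat_span i j (x * y) = quat_span i j y * quat_span i j x"
proof -
  have [simp]: "e * i = i" "i * e = i" "e * j = j" "j * e = j" "e * e = e"
    "j * i * e = j * i" "e * (j * i) = j * i"
    using assms(1,2) by (simp_all add: unit_left unit_right closed)
  \<comment> \<open>With k for \<open>j * i\<close>, these are the quaternion rules ki = j, ik = -j,
    kj = -i, jk = i, kk = -1 with every product reversed.\<close>
  have [simp]: "i * (j * i) = j" "j * i * i = - j" "j * (j * i) = - i" "j * i * j = i"
    "j * i * (j * i) = - e"
  proof -
    show 1: "i * (j * i) = j"
      using assms by (metis \<open>j * e = j\<close> mult.assoc mult_minus_left mult_minus_right minus_minus)
    show "j * i * i = - j"
      using assms by (simp add: mult.assoc)
    show "j * (j * i) = - i"
      using assms by (simp flip: mult.assoc)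
    show "j * i * j = i"
      using assms by (simp add: mult.assoc flip: mult.assoc[of j j])
    show "j * i * (j * i) = - e"
      using assms 1 by (simp add: mult.assoc)
  qed
  show ?thesis
    by (simp add: quat_span_def quat_defs algebra_simps assms(3-5))
qed

text \<open>If \<open>S\<close> is not just the reals, pick \<open>i\<close> with square
  \<open>- e\<close>. Conjugation by \<open>i\<close> splits \<open>S\<close> into elements
  commuting with \<open>i\<close>, which form a copy of the complex numbers, and elements
  anticommuting with \<open>i\<close>. If the second part is zero, \<open>S\<close> is complex;
  otherwise it provides \<open>j\<close>, and \<open>S\<close> is quaternionic.
  \<open>\<psi>\<close> reverses products because the corner will act from the right.\<close>

theorem frobenius:
  obtains K \<psi> where "K \<in> {range of_real, range quat_of_complex, UNIV}" "linear \<psi>"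
    "\<psi> 1 = e" "\<And>x y. \<lbrakk>x \<in> K; y \<in> K\<rbrakk> \<Longrightarrow> \<psi> (x * y) = \<psi> y * \<psi> x" "\<psi> ` K = S"
proof (cases "S \<subseteq> range (\<lambda>a. a *\<^sub>R e)")
  case True
  have [simp]: "e * e = e" using unit_left closed by auto
  show thesis
  proof
    show "range of_real \<in> {range of_real, range quat_of_complex, UNIV :: quat set}" by simp
    \<comment> \<open>The values 0 for i and j are defaults: real quaternions have zero coefficients
      there.\<close>
    show "quat_span 0 0 ` range of_real = S"
    proof
      show "S \<subseteq> quat_span 0 0 ` range of_real"
        using True by (force simp: quat_span_def of_real_quat image_def)
    qed (use quat_span_closed closed in blast)
    show "quat_span 0 0 (x * y) = quat_span 0 0 y * quat_span 0 0 x"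
      if "x \<in> range of_real" "y \<in> range of_real" for x y
      using that by (auto simp: quat_span_def of_real_quat times_quat_def)
  qed (auto simp: linear_quat_span quat_span_one)
next
  case False
  then obtain x where x: "x \<in> S" "x \<notin> range (\<lambda>a. a *\<^sub>R e)" by blast
  obtain a s where "(s *\<^sub>R (x - a *\<^sub>R e)) * (s *\<^sub>R (x - a *\<^sub>R e)) = - e"
    by (rule imaginary_part[OF x])
  then obtain i where i: "i \<in> S" "i * i = - e"
    using x(1) that[of "s *\<^sub>R (x - a *\<^sub>R e)"] by (simp add: closed)
  note unit [simp] = unit_left unit_right
  \<comment> \<open>The centraliser of \<open>i\<close> is spanned by \<open>e\<close> and
    \<open>i\<close>: the normalised imaginary part \<open>z\<close> of \<open>y\<close> commutes
    with \<open>i\<close> and has the same square, so \<open>(z - i) * (z + i) = 0\<close>.\<close>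
  have C: "\<exists>a b. y = a *\<^sub>R e + b *\<^sub>R i" if y: "y \<in> S" "y * i = i * y" for y
  proof (cases "y \<in> range (\<lambda>a. a *\<^sub>R e)")
    case True
    then show ?thesis by (metis add.right_neutral imageE scaleR_zero_left)
  next
    case False
    obtain a s where s: "s \<noteq> 0" "(s *\<^sub>R (y - a *\<^sub>R e)) * (s *\<^sub>R (y - a *\<^sub>R e)) = - e"
      by (rule imaginary_part[OF y(1) False])
    define z where "z = s *\<^sub>R (y - a *\<^sub>R e)"
    have z: "z \<in> S" "z * i = i * z" "z * z = - e"
      using s y i by (simp_all add: z_def algebra_simps closed)
    have "(z - i) * (z + i) = 0"
      using z i by (simp add: algebra_simps)
    then have "z - i = 0 \<or> z + i = 0"
      using no_zero_divisors[of "z - i" "z + i"] z(1) i(1) by (simp add: closed)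
    then have "z = 1 *\<^sub>R i \<or> z = (- 1) *\<^sub>R i"
      by (auto simp: eq_neg_iff_add_eq_0)
    then obtain t where t: "z = t *\<^sub>R i" by blast
    have "y = a *\<^sub>R e + (1 / s) *\<^sub>R z"
      using s(1) by (simp add: z_def)
    also have "\<dots> = a *\<^sub>R e + (t / s) *\<^sub>R i"
      by (simp add: t)
    finally have "y = a *\<^sub>R e + (t / s) *\<^sub>R i" .
    then show ?thesis by blast
  qed
  show thesis
  proof (cases "\<exists>j\<in>S. j \<noteq> 0 \<and> i * j = - (j * i)")
    case False
    show thesis
    proof
      show "range quat_of_complex \<in> {range of_real, range quat_of_complex, UNIV}" by simp
      show "quat_span i 0 ` range quat_of_complex = S"
      proof
        show "S \<subseteq> quat_span i 0 ` range quat_of_complex"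
        proof
          fix y assume y: "y \<in> S"
          \<comment> \<open>This is twice the part of \<open>y\<close> that anticommutes with
            \<open>i\<close>. Its vanishing means that \<open>y\<close> commutes with
            \<open>i\<close>.\<close>
          define j where "j = y + i * y * i"
          have "i * j = - (j * i)" "j \<in> S"
            using y i by (auto simp: j_def algebra_simps closed simp flip: mult.assoc)
              (auto simp: mult.assoc i y closed)
          then have "j = 0" using False by blast
          then have "i * j = 0" by simp
          then have "y * i = i * y"
            using y i by (simp add: j_def distrib_left closed flip: mult.assoc)
          then obtain a b where "y = a *\<^sub>R e + b *\<^sub>R i" using C y by blast
          then have "y = quat_span i 0 (quat_of_complex (Complex a b))"
            by (simp add: quat_span_def quat_of_complex_def)
          then show "y \<in> quat_span i 0 ` range quat_of_complex" by blast
        qed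
      qed (use i quat_span_closed closed in blast)
      show "quat_span i 0 (x * y) = quat_span i 0 y * quat_span i 0 x"
        if "x \<in> range quat_of_complex" "y \<in> range quat_of_complex" for x y
        using that i
        by (auto simp: quat_span_def quat_of_complex_def times_quat_def algebra_simps closed)
    qed (auto simp: linear_quat_span quat_span_one)
  next
    case True
    then obtain j' where j': "j' \<in> S" "j' \<noteq> 0" "i * j' = - (j' * i)" by blast
    have minus: "y = 0" if "y * i = i * y" "i * y = - (y * i)" "y \<in> S" for y
    proof -
      have "i * y + i * y = 0"
        using that(1,2) by (metis eq_neg_iff_add_eq_0)
      then have "i * y = 0"
        by (simp flip: scaleR_2)
      moreover have "i \<noteq> 0"
        using i(2) unit_nonzero by auto
      ultimately show ?thesis
        using no_zero_divisors[OF i(1) that(3)] by simp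
    qed
    have j'_not_real: "j' \<notin> range (\<lambda>a. a *\<^sub>R e)"
    proof
      assume "j' \<in> range (\<lambda>a. a *\<^sub>R e)"
      then have "j' * i = i * j'" using i(1) by auto
      then show False using minus j' by blast
    qed
    \<comment> \<open>The square of \<open>j'\<close> commutes with \<open>i\<close>, hence so does
      \<open>a *\<^sub>R j'\<close>. It also anticommutes with \<open>i\<close>, so it is zero and
      the square of \<open>j'\<close> is real.\<close>
    obtain a b where ab: "j' * j' = a *\<^sub>R j' + b *\<^sub>R e"
      using quadratic j' by blast
    have "j' * j' * i = i * (j' * j')"
      using j'(3) by (metis add.inverse_inverse mult.assoc mult_minus_left mult_minus_right)
    then have "(a *\<^sub>R j') * i = i * (a *\<^sub>R j')"
      using i(1) by (simp add: ab distrib_left distrib_right)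
    moreover have "i * (a *\<^sub>R j') = - ((a *\<^sub>R j') * i)"
      using j'(3) by simp
    moreover have "a *\<^sub>R j' \<in> S"
      using j'(1) closed by simp
    ultimately have "a *\<^sub>R j' = 0"
      by (rule minus)
    then have "j' * j' = b *\<^sub>R e" using ab by simp
    then obtain s where "s \<noteq> 0" "(s *\<^sub>R j') * (s *\<^sub>R j') = - e"
      by (rule imaginary_normalise[OF j'(1) j'_not_real])
    then obtain j where j: "j \<in> S" "j * j = - e" "i * j = - (j * i)"
      using j'(1,3) by (intro that[of "s *\<^sub>R j'"]) (simp_all add: closed)
    show thesis
    proof
      show "UNIV \<in> {range of_real, range quat_of_complex, UNIV}" by simp
      show "quat_span i j ` UNIV = S"
      proof
        show "S \<subseteq> quat_span i j ` UNIV"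
        proof
          fix y assume y: "y \<in> S"
          \<comment> \<open>\<open>u\<close> is twice the commuting part of \<open>y\<close>. Left
            multiplication by \<open>j\<close> carries the anticommuting part into the centraliser
            of \<open>i\<close>, which gives \<open>v\<close>. Both are therefore combinations of
            \<open>e\<close> and \<open>i\<close>, and \<open>y\<close> is recovered from
            \<open>2 *\<^sub>R y = u - j * v\<close>.\<close>
          define u where "u = y - i * y * i"
          define v where "v = j * (y + i * y * i)"
          have u: "u \<in> S" "u * i = i * u"
            using y i by (auto simp: u_def algebra_simps closed simp flip: mult.assoc)
              (auto simp: mult.assoc i y closed)
          have v: "v \<in> S" "v * i = i * v"
          proof -
            show "v \<in> S" using y i j by (simp add: v_def closed)
            have "i * v = - (j * (i * (y + i * y * i)))"
              by (simp add: v_def j flip: mult.assoc)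
            also have "i * (y + i * y * i) = - ((y + i * y * i) * i)"
              using y i by (simp add: algebra_simps closed flip: mult.assoc)
                (simp add: mult.assoc i y closed)
            finally show "v * i = i * v" by (simp add: v_def mult.assoc)
          qed
          obtain a b where ab: "u = a *\<^sub>R e + b *\<^sub>R i" using C u by blast
          obtain c d where cd: "v = c *\<^sub>R e + d *\<^sub>R i" using C v by blast
          have "j * v = - (y + i * y * i)"
            using y i j by (simp add: v_def closed flip: mult.assoc)
          then have "2 *\<^sub>R y = u - j * v"
            by (simp add: u_def scaleR_2)
          also have "\<dots> = 2 *\<^sub>R quat_span i j (Quat (a/2) (b/2) (-c/2) (-d/2))"
            using j i by (simp add: ab cd quat_span_def algebra_simps)
          finally have "y = quat_span i j (Quat (a/2) (b/2) (-c/2) (-d/2))" by simp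
          then show "y \<in> quat_span i j ` UNIV" by blast
        qed
      qed (use i j quat_span_closed in blast)
      show "quat_span i j (x * y) = quat_span i j y * quat_span i j x" for x y
        using quat_span_mult i j by blast
    qed (auto simp: linear_quat_span quat_span_one)
  qed
qed

end

section \<open>Primitive idempotents\<close>

definition left_ideal :: "'a::real_algebra set \<Rightarrow> bool" where
  "left_ideal I \<longleftrightarrow> subspace I \<and> (\<forall>a. \<forall>x\<in>I. a * x \<in> I)"

text \<open>The last clause makes Ae a minimal left ideal: the condition \<open>y * e = y\<close>
  says that \<open>y\<close> lies in Ae, and every nonzero such \<open>y\<close> generates
  Ae.\<close>

definition primitive_idempotent :: "'a::real_algebra \<Rightarrow> bool" where
  "primitive_idempotent e \<longleftrightarrow>
    e \<noteq> 0 \<and> e * e = e \<and> (\<forall>y. y * e = y \<longrightarrow> y \<noteq> 0 \<longrightarrow> (\<exists>z. z * y = e))"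

definition principal_ideal :: "'a::real_algebra \<Rightarrow> 'a set" where
  "principal_ideal e = span {x * e * y | x y. True}"

text \<open>The space eAf is the space of homomorphisms from Ae to Af, so the last clause says that
  distinct members give non-isomorphic minimal left ideals. This is stronger than
  \<open>e * f = 0\<close>.\<close>

definition orthogonal_primitive_family :: "'a::real_algebra set \<Rightarrow> bool" where
  "orthogonal_primitive_family F \<longleftrightarrow> finite F \<and> (\<forall>e\<in>F. primitive_idempotent e) \<and>
    (\<forall>e\<in>F. \<forall>f\<in>F. e \<noteq> f \<longrightarrow> (\<forall>a. e * a * f = 0))"

definition ideal_generated :: "'a::real_algebra set \<Rightarrow> 'a set" where
  "ideal_generated F = span {x * e * y | x e y. e \<in> F}"

lemma left_idealD: "left_ideal I \<Longrightarrow> x \<in> I \<Longrightarrow> a * x \<in> I"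
  by (simp add: left_ideal_def)

lemma left_ideal_subspace: "left_ideal I \<Longrightarrow> subspace I"
  by (simp add: left_ideal_def)

lemma left_ideal_span:
  assumes "\<And>a x. x \<in> X \<Longrightarrow> a * x \<in> span X"
  shows "left_ideal (span X)"
  unfolding left_ideal_def
proof (intro conjI allI ballI)
  fix a x assume "x \<in> span X"
  then show "a * x \<in> span X"
    by (induction rule: span_induct_alt)
      (auto simp: distrib_left span_zero intro!: span_add span_scale assms)
qed simp

lemma left_ideal_principal: "left_ideal {z * y | z. True}" for y :: "'a::real_algebra"
  unfolding left_ideal_def subspace_def
proof (intro conjI allI ballI)
  show "0 \<in> {z * y | z. True}"
    by (intro CollectI exI[of _ 0]) simp
next
  fix u v assume "u \<in> {z * y | z. True}" "v \<in> {z * y | z. True}"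
  then show "u + v \<in> {z * y | z. True}"
    by (auto simp flip: distrib_right)
next
  fix r :: real and v assume "v \<in> {z * y | z. True}"
  then show "r *\<^sub>R v \<in> {z * y | z. True}"
    by (auto simp flip: mult_scaleR_left)
next
  fix a v assume "v \<in> {z * y | z. True}"
  then show "a * v \<in> {z * y | z. True}"
    by (auto simp flip: mult.assoc)
qed

section \<open>Idempotents in a semisimple algebra of finite dimension\<close>

locale semisimple_real_algebra =
  fixes B :: "'a::real_algebra_1 set"
  assumes finite_spanning: "finite B" and spanning: "span B = UNIV"
    and complement: "left_ideal (I :: 'a set) \<Longrightarrow>
      \<exists>J. left_ideal J \<and> I \<inter> J = {0} \<and> (\<forall>x. \<exists>y\<in>I. \<exists>z\<in>J. x = y + z)"
begin

lemma finite_independent: "independent S \<Longrightarrow> finite S" "independent S \<Longrightarrow> card S \<le> card B"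
  for S :: "'a set"
  using real_vector.independent_span_bound[OF finite_spanning, of S] spanning by auto

lemma dim_le: "dim S \<le> card B" for S :: "'a set"
  using basis_exists[of S] finite_independent by metis

lemma dim_strict_mono:
  fixes S T :: "'a set"
  assumes "subspace S" "subspace T" "S \<subset> T"
  shows "dim S < dim T"
proof -
  obtain X where X: "X \<subseteq> S" "independent X" "S \<subseteq> span X" "card X = dim S"
    by (rule basis_exists)
  obtain t where t: "t \<in> T" "t \<notin> S" using assms by blast
  have "span X = S"
    using X assms(1) span_minimal by blast
  then have ind: "independent (insert t X)" and tX: "t \<notin> X"
    using X t by (auto simp: independent_insert)
  have "insert t X \<subseteq> T" using X(1) t(1) assms(3) by blast
  then obtain Y where Y: "insert t X \<subseteq> Y" "Y \<subseteq> T" "independent Y" "T \<subseteq> span Y"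
    by (rule maximal_independent_subset_extend[OF _ ind])
  have "Suc (card X) = card (insert t X)"
    using tX finite_independent(1)[OF X(2)] by simp
  also have "\<dots> \<le> card Y"
    using Y(1) finite_independent(1)[OF Y(3)] by (rule card_mono[rotated])
  also have "\<dots> = dim T"
    by (rule basis_card_eq_dim[OF Y(2,4,3)])
  finally show ?thesis using X(4) by simp
qed

text \<open>Take a nonzero left ideal \<open>L\<close> inside \<open>J\<close> of least dimension
  and split 1 along \<open>L\<close> and a complement. The component \<open>e\<close> in
  \<open>L\<close> is a right unit of \<open>L\<close>, and minimality of \<open>L\<close> turns
  into primitivity of \<open>e\<close>.\<close>

lemma primitive_idempotent_exists:
  fixes J :: "'a set"
  assumes "left_ideal J" "J \<noteq> {0}"
  obtains e where "e \<in> J" "primitive_idempotent e"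
proof -
  define P where "P L \<longleftrightarrow> left_ideal L \<and> L \<noteq> {0} \<and> L \<subseteq> J" for L
  have "\<exists>L. P L \<and> (\<forall>M. P M \<longrightarrow> dim L \<le> dim M)"
    using assms by (intro ex_has_least_nat[of P J dim]) (auto simp: P_def)
  then obtain L where L: "left_ideal L" "L \<noteq> {0}" "L \<subseteq> J"
    and min: "\<And>M. P M \<Longrightarrow> dim L \<le> dim M"
    unfolding P_def by blast
  obtain L' where L': "left_ideal L'" "L \<inter> L' = {0}" "\<forall>x. \<exists>y\<in>L. \<exists>z\<in>L'. x = y + z"
    using complement[OF L(1)] by blast
  obtain e e' where e: "e \<in> L" "e' \<in> L'" "1 = e + e'"
    using L'(3) by blast
  \<comment> \<open>\<open>x * e'\<close> equals \<open>x - x * e\<close>, so it lies in both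
    \<open>L\<close> and its complement.\<close>
  have unit: "x * e = x" if x: "x \<in> L" for x
  proof -
    have "x * e' = x - x * e"
      using arg_cong[OF e(3)[symmetric], of "\<lambda>u. x * u"]
      by (simp add: distrib_left eq_diff_eq add.commute)
    also have "\<dots> \<in> L"
      using x e L by (intro subspace_diff left_ideal_subspace left_idealD)
    finally have "x * e' \<in> L \<inter> L'"
      using left_idealD[OF L'(1) e(2)] by blast
    with L' have "x * e' = 0" by blast
    with \<open>x * e' = x - x * e\<close> show ?thesis by simp
  qed
  have "e \<noteq> 0"
  proof
    assume "e = 0"
    then have "L \<subseteq> {0}" using unit by force
    with L subspace_0[OF left_ideal_subspace[OF L(1)]] show False by blast
  qed
  moreover have "\<exists>z. z * y = e" if y: "y * e = y" "y \<noteq> 0" for y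
  proof -
    let ?M = "{z * y | z. True}"
    have yL: "y \<in> L" using y(1) left_idealD[OF L(1) e(1)] by metis
    have sub: "?M \<subseteq> L" using yL left_idealD[OF L(1)] by blast
    have "y \<in> ?M" by (intro CollectI exI[of _ 1]) simp
    then have "P ?M"
      unfolding P_def using y(2) sub L(3) left_ideal_principal by blast
    then have "dim L \<le> dim ?M" by (rule min)
    then have "\<not> ?M \<subset> L"
      using dim_strict_mono[OF left_ideal_subspace[OF left_ideal_principal] left_ideal_subspace[OF L(1)]]
      by force
    then have "?M = L" using sub by blast
    then show ?thesis using e(1) by blast
  qed
  ultimately have "primitive_idempotent e"
    using unit[OF e(1)] by (simp add: primitive_idempotent_def)
  then show thesis using that e(1) L(3) by blast
qed

text \<open>Maximality is measured by the dimension of the generated ideal, which is bounded by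
  \<open>card B\<close>. A primitive idempotent in a complement of the ideal could be adjoined to
  the family and would increase this dimension.\<close>

lemma complete_orthogonal_family_exists:
  obtains F :: "'a set" where "orthogonal_primitive_family F" "ideal_generated F = UNIV"
proof -
  have "\<exists>F :: 'a set. orthogonal_primitive_family F \<and>
      (\<forall>F' :: 'a set. orthogonal_primitive_family F' \<longrightarrow>
        dim (ideal_generated F') \<le> dim (ideal_generated F))"
    by (rule ex_has_greatest_nat[where k = "{}" and b = "Suc (card B)"])
      (auto simp: orthogonal_primitive_family_def dim_le le_imp_less_Suc)
  then obtain F :: "'a set" where F: "orthogonal_primitive_family F"
    and max: "\<And>F' :: 'a set. orthogonal_primitive_family F' \<Longrightarrow>
      dim (ideal_generated F') \<le> dim (ideal_generated F)"
    by blast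
  let ?I = "ideal_generated F"
  have gen: "x * e * y \<in> ?I" if "e \<in> F" for x e y
    unfolding ideal_generated_def using that by (intro span_base) blast
  have "left_ideal ?I"
    unfolding ideal_generated_def
  proof (rule left_ideal_span)
    fix a x assume "x \<in> {x * e * y | x e y. e \<in> F}"
    then obtain u e y where "x = u * e * y" "e \<in> F" by blast
    then have "a * x = (a * u) * e * y" by (simp add: mult.assoc)
    with \<open>e \<in> F\<close> show "a * x \<in> span {x * e * y | x e y. e \<in> F}"
      by (intro span_base) blast
  qed
  then obtain J where J: "left_ideal J" "?I \<inter> J = {0}" "\<forall>x. \<exists>y\<in>?I. \<exists>z\<in>J. x = y + z"
    using complement[OF \<open>left_ideal ?I\<close>] by blast
  have "J = {0}"
  proof (rule ccontr)
    assume "J \<noteq> {0}"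
    then obtain e where e: "e \<in> J" "primitive_idempotent e"
      using primitive_idempotent_exists J(1) by blast
    \<comment> \<open>The product lies in the ideal because of \<open>f\<close> and in the left
      ideal \<open>J\<close> because of \<open>e\<close>.\<close>
    have left: "f * a * e = 0" if "f \<in> F" for f a
    proof -
      have "1 * f * (a * e) \<in> ?I" using gen that by blast
      moreover have "(f * a) * e \<in> J" using left_idealD J(1) e(1) by blast
      ultimately have "f * a * e \<in> ?I \<inter> J" by (simp add: mult.assoc)
      then show ?thesis using J(2) by blast
    qed
    \<comment> \<open>If this product were nonzero, minimality of Af would give
      \<open>f = z * (e * a * f)\<close>. Multiplying by \<open>f\<close> on the left exhibits the
      factor \<open>f * z * e\<close>, which is zero by \<open>left\<close>.\<close>
    have right: "e * a * f = 0" if "f \<in> F" for f a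
    proof (rule ccontr)
      assume nz: "e * a * f \<noteq> 0"
      have f: "primitive_idempotent f"
        using F that by (simp add: orthogonal_primitive_family_def)
      then have "(e * a * f) * f = e * a * f"
        by (simp add: primitive_idempotent_def mult.assoc)
      then obtain z where z: "z * (e * a * f) = f"
        using f nz by (auto simp: primitive_idempotent_def)
      then have "f = f * (z * (e * a * f))"
        using f by (simp add: primitive_idempotent_def)
      also have "\<dots> = (f * z * e) * (a * f)"
        by (simp add: mult.assoc)
      also have "\<dots> = 0" using left[OF that] by simp
      finally show False using f by (simp add: primitive_idempotent_def)
    qed
    have F': "orthogonal_primitive_family (insert e F)"
      using F e(2) left right by (auto simp: orthogonal_primitive_family_def)
    have "e \<noteq> 0" "e = e * e * e"
      using e(2) by (auto simp: primitive_idempotent_def)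
    then have "e \<notin> ?I" using J(2) e(1) by blast
    moreover have "e \<in> ideal_generated (insert e F)"
      unfolding ideal_generated_def using \<open>e = e * e * e\<close> by (intro span_base) blast
    moreover have "?I \<subseteq> ideal_generated (insert e F)"
      unfolding ideal_generated_def by (intro span_mono) blast
    ultimately have "dim ?I < dim (ideal_generated (insert e F))"
      by (intro dim_strict_mono) (auto simp: ideal_generated_def)
    with max[OF F'] show False by simp
  qed
  then have "?I = UNIV" using J(3) by force
  with F that show thesis by blast
qed

end

section \<open>Double centraliser property and faithfulness\<close>

text \<open>For \<open>c = s e t\<close> take \<open>a = f (s e) e t\<close>, since \<open>e t v\<close> lies in \<open>eAe\<close> for \<open>v\<close> in \<open>Ae\<close>.\<close>

lemma principal_ideal_acts:
  assumes e: "e * e = e" and c: "c \<in> principal_ideal e"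
    and f_closed: "\<And>v. v * e = v \<Longrightarrow> f v * e = f v"
    and f_add: "\<And>v w. \<lbrakk>v * e = v; w * e = w\<rbrakk> \<Longrightarrow> f (v + w) = f v + f w"
    and f_mult: "\<And>v d. \<lbrakk>v * e = v; e * d = d; d * e = d\<rbrakk> \<Longrightarrow> f (v * d) = f v * d"
  shows "\<exists>a\<in>principal_ideal e. \<forall>v. v * e = v \<longrightarrow> f (c * v) = a * v"
proof -
  \<comment> \<open>Real scalars act as right multiplication by \<open>r *\<^sub>R e\<close>, an
    element of eAe, so homogeneity is an instance of \<open>f_mult\<close>.\<close>
  have f_scale: "f (r *\<^sub>R v) = r *\<^sub>R f v" if "v * e = v" for r v
    using f_mult[OF that, of "r *\<^sub>R e"] that f_closed[OF that] e by simp
  have f_0: "f 0 = 0"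
    using f_scale[of 0 0] by simp
  show ?thesis
    using c unfolding principal_ideal_def
  proof (induction rule: span_induct_alt)
    case base
    then show ?case by (intro bexI[of _ 0]) (auto simp: f_0 span_zero)
  next
    case (step r x c)
    obtain s t where x: "x = s * e * t" using step(1) by blast
    obtain a where a: "a \<in> span {x * e * y | x y. True}" "\<forall>v. v * e = v \<longrightarrow> f (c * v) = a * v"
      using step by blast
    define b where "b = f (s * e) * e * t"
    have b: "b \<in> span {x * e * y | x y. True}"
      unfolding b_def by (intro span_base) blast
    have "f ((r *\<^sub>R x + c) * v) = (r *\<^sub>R b + a) * v" if v: "v * e = v" for v
    proof -
      have ev: "(s * e) * e = s * e" "e * (e * t * v) = e * t * v" "(e * t * v) * e = e * t * v"
        "x * v * e = x * v" "c * v * e = c * v"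
        using e v by (simp_all add: mult.assoc) (simp_all flip: mult.assoc add: e)
      have "x * v = (s * e) * (e * t * v)"
        using e by (simp add: x mult.assoc) (simp flip: mult.assoc)
      then have "f (x * v) = f (s * e) * (e * t * v)"
        using f_mult[OF ev(1-3)] by simp
      also have "\<dots> = b * v"
        by (simp add: b_def mult.assoc)
      finally have "f (x * v) = b * v" .
      then show ?thesis
        using a(2) v ev(4,5) f_add[of "r *\<^sub>R (x * v)" "c * v"] f_scale[of "x * v" r]
        by (simp add: distrib_right)
    qed
    moreover have "r *\<^sub>R b + a \<in> span {x * e * y | x y. True}"
      using a b by (intro span_add span_scale)
    ultimately show ?case by blast
  qed
qed

lemma ideal_generated_decomposes:
  assumes "finite F" "v \<in> ideal_generated F"
  shows "\<exists>c. (\<forall>e\<in>F. c e \<in> principal_ideal e) \<and> v = (\<Sum>e\<in>F. c e)"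
  using assms(2) unfolding ideal_generated_def
proof (induction rule: span_induct_alt)
  case base
  show ?case by (intro exI[of _ "\<lambda>_. 0"]) (simp add: principal_ideal_def span_zero)
next
  case (step r x v)
  then obtain c where c: "\<forall>e\<in>F. c e \<in> principal_ideal e" "v = (\<Sum>e\<in>F. c e)" by blast
  obtain s e t where x: "x = s * e * t" "e \<in> F" using step by blast
  define d where "d f = (if f = e then r *\<^sub>R x else 0) + c f" for f
  have "x \<in> principal_ideal e"
    unfolding principal_ideal_def x(1) by (intro span_base) blast
  then have "d f \<in> principal_ideal f" if "f \<in> F" for f
    using c that by (auto simp: d_def principal_ideal_def intro: span_add span_scale)
  moreover have "r *\<^sub>R x + v = (\<Sum>f\<in>F. d f)"
    using assms(1) x(2) by (simp add: d_def sum.distrib c(2))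
  ultimately show ?case by blast
qed

text \<open>AeA annihilates Af because eAf = 0.\<close>

lemma principal_ideal_orthogonal:
  assumes "a \<in> principal_ideal e" "\<And>y. e * y * f = 0" "v * f = v"
  shows "a * v = 0"
  using assms(1) unfolding principal_ideal_def
proof (induction rule: span_induct_alt)
  case (step r x a)
  then obtain s t where "x = s * e * t" by blast
  then have "x * v = s * (e * (t * v) * f)"
    using assms(3) by (simp add: mult.assoc)
  then show ?case using step assms(2) by (simp add: distrib_right)
qed simp

text \<open>Write 1 as a sum of elements \<open>c e\<close> of AeA. On Ae only the summand
  \<open>c e\<close> acts, hence as the identity, and \<open>f e v = f e (c e * v)\<close> is left
  multiplication by some \<open>a e\<close> in AeA. Each \<open>a e\<close> kills the other ideals
  Af, so the sum of the \<open>a e\<close> realises all the maps at once.\<close>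

lemma double_centraliser:
  fixes F :: "'a::real_algebra_1 set"
  assumes F: "orthogonal_primitive_family F" and full: "ideal_generated F = UNIV"
    and f_closed: "\<And>e v. \<lbrakk>e \<in> F; v * e = v\<rbrakk> \<Longrightarrow> f e v * e = f e v"
    and f_add: "\<And>e v w. \<lbrakk>e \<in> F; v * e = v; w * e = w\<rbrakk> \<Longrightarrow> f e (v + w) = f e v + f e w"
    and f_mult: "\<And>e v d. \<lbrakk>e \<in> F; v * e = v; e * d = d; d * e = d\<rbrakk> \<Longrightarrow> f e (v * d) = f e v * d"
  obtains a where "\<And>e v. \<lbrakk>e \<in> F; v * e = v\<rbrakk> \<Longrightarrow> f e v = a * v"
proof -
  have fin: "finite F" and idem: "\<And>e. e \<in> F \<Longrightarrow> e * e = e"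
    and orth: "\<And>e f a. \<lbrakk>e \<in> F; f \<in> F; e \<noteq> f\<rbrakk> \<Longrightarrow> e * a * f = 0"
    using F by (auto simp: orthogonal_primitive_family_def primitive_idempotent_def)
  obtain c where c: "\<And>e. e \<in> F \<Longrightarrow> c e \<in> principal_ideal e" "1 = (\<Sum>e\<in>F. c e)"
    using ideal_generated_decomposes[OF fin, of 1] full by blast
  have "\<forall>e\<in>F. \<exists>a\<in>principal_ideal e. \<forall>v. v * e = v \<longrightarrow> f e (c e * v) = a * v"
    using c idem f_closed f_add f_mult by (intro ballI principal_ideal_acts) auto
  then obtain a where a: "\<And>e. e \<in> F \<Longrightarrow> a e \<in> principal_ideal e"
    "\<And>e v. \<lbrakk>e \<in> F; v * e = v\<rbrakk> \<Longrightarrow> f e (c e * v) = a e * v"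
    by metis
  have only: "(\<Sum>e\<in>F. g e) * v = g e' * v"
    if "\<And>e. e \<in> F \<Longrightarrow> g e \<in> principal_ideal e" "e' \<in> F" "v * e' = v" for g e' v
  proof -
    have "(\<Sum>e\<in>F. g e * v) = (\<Sum>e\<in>F. if e = e' then g e * v else 0)"
      using principal_ideal_orthogonal[OF that(1) orth[OF _ that(2)] that(3)]
      by (intro sum.cong) auto
    then show ?thesis using fin that by (simp add: sum_distrib_right)
  qed
  show thesis
  proof
    fix e v assume ev: "e \<in> F" "v * e = v"
    have "c e * v = v" using only[of c, OF c(1) ev] c(2) by simp
    then show "f e v = (\<Sum>e\<in>F. a e) * v"
      using only[of a, OF a(1) ev] a(2)[OF ev] by simp
  qed
qed

text \<open>Expand 1 in products \<open>s * e * t\<close>; each \<open>s * e\<close> lies in Ae and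
  is killed by \<open>a\<close>, hence \<open>a * 1 = 0\<close>.\<close>

lemma faithful:
  fixes a :: "'a::real_algebra_1"
  assumes full: "ideal_generated F = UNIV"
    and "\<And>e v. \<lbrakk>e \<in> F; v * e = v\<rbrakk> \<Longrightarrow> a * v = 0" and idem: "\<And>e. e \<in> F \<Longrightarrow> e * e = e"
  shows "a = 0"
proof -
  have "1 \<in> ideal_generated F" using full by simp
  then have "a * 1 = 0"
    unfolding ideal_generated_def
  proof (induction rule: span_induct_alt)
    case (step r x v)
    then obtain s e t where x: "x = s * e * t" "e \<in> F" by blast
    then have "a * (s * e) = 0"
      using idem by (intro assms(2)[of e]) (auto simp: mult.assoc)
    then have "a * x = 0" by (simp add: x(1) flip: mult.assoc)
    then show ?case using step by (simp add: distrib_left)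
  qed simp
  then show ?thesis by simp
qed

section \<open>Maschke's theorem\<close>

text \<open>Associativity enters here: the multiplication of the graded algebra is that of the class
  \<open>real_algebra_1\<close>.\<close>

locale finite_graded_twisted_algebra = graded_twisted_algebra G W "(*)" 1
  for G :: "('g, 'm) monoid_scheme" (structure) and W :: "'g \<Rightarrow> 'w::real_algebra_1 set" +
  assumes finite_group: "finite (carrier G)"
begin

lemma component_line:
  assumes "g \<in> carrier G"
  obtains w where "w \<noteq> 0" "W g = span {w}"
proof -
  have W: "subspace (W g)"
    using grading assms by (simp add: direct_sum_decomposition_def)
  obtain X where X: "X \<subseteq> W g" "independent X" "W g \<subseteq> span X" "card X = dim (W g)"
    by (rule basis_exists)
  then have "card X = 1" using one_dimensional assms by simp
  then obtain w where "X = {w}" by (rule card_1_singletonE)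
  moreover from this have "w \<noteq> 0" using X(2) dependent_zero by blast
  moreover have "span X = W g" using X W span_minimal by blast
  ultimately show thesis using that by blast
qed

definition hom_basis :: "'g \<Rightarrow> 'w" where
  "hom_basis g = (SOME w. w \<noteq> 0 \<and> W g = span {w})"

lemma hom_basis:
  assumes "g \<in> carrier G"
  shows "hom_basis g \<noteq> 0" "W g = span {hom_basis g}" "hom_basis g \<in> W g"
proof -
  obtain w where "w \<noteq> 0" "W g = span {w}"
    by (rule component_line[OF assms])
  then have "w \<noteq> 0 \<and> W g = span {w}" by simp
  then have *: "hom_basis g \<noteq> 0 \<and> W g = span {hom_basis g}"
    unfolding hom_basis_def by (rule someI)
  then show "hom_basis g \<noteq> 0" "W g = span {hom_basis g}" by auto
  show "hom_basis g \<in> W g"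
    unfolding conjunct2[OF *] by (rule span_base) simp
qed

lemma span_hom_basis: "span (hom_basis ` carrier G) = UNIV"
proof -
  have "x \<in> span (hom_basis ` carrier G)" for x
  proof -
    obtain c where c: "\<forall>g\<in>carrier G. c g \<in> W g" "\<forall>g. g \<notin> carrier G \<longrightarrow> c g = 0"
      "x = (\<Sum>g | c g \<noteq> 0. c g)"
      using grading unfolding direct_sum_decomposition_def by blast
    have "c g \<in> span (hom_basis ` carrier G)" if "c g \<noteq> 0" for g
    proof -
      have g: "g \<in> carrier G" using c(2) that by blast
      then have "c g \<in> span {hom_basis g}" using c(1) hom_basis(2) by blast
      then show ?thesis using span_mono[of "{hom_basis g}" "hom_basis ` carrier G"] g by blast
    qed
    then show ?thesis unfolding c(3) by (intro span_sum) simp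
  qed
  then show ?thesis by blast
qed

text \<open>Products with a nonzero element of the component of \<open>inv g\<close> are nonzero
  elements of the identity component, which consists of the real multiples of 1. The resulting right
  and left inverses agree.\<close>

lemma invertible_component:
  assumes g: "g \<in> carrier G" and x: "x \<in> W g" "x \<noteq> 0"
  shows "\<exists>y. x * y = 1 \<and> y * x = 1"
proof -
  have unit: "\<exists>s. s \<noteq> 0 \<and> z = s *\<^sub>R (1::'w)" if z: "z \<in> W \<one>" "z \<noteq> 0" for z
  proof -
    obtain w where w: "w \<noteq> 0" "W \<one> = span {w}"
      using component_line[OF one_closed] by blast
    obtain a where a: "1 = a *\<^sub>R w"
      using unit_degree unfolding w(2) span_singleton by blast
    obtain b where b: "z = b *\<^sub>R w"
      using z(1) unfolding w(2) span_singleton by blast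
    have "a \<noteq> 0" using a by auto
    then have "z = (b / a) *\<^sub>R 1" unfolding a b by simp
    then show ?thesis using z(2) by (intro exI[of _ "b / a"]) auto
  qed
  let ?y = "hom_basis (inv g)"
  have y: "?y \<in> W (inv g)" "?y \<noteq> 0"
    using hom_basis g by auto
  have "x * ?y \<in> W \<one>" "?y * x \<in> W \<one>" "x * ?y \<noteq> 0" "?y * x \<noteq> 0"
    using mul_graded[of g "inv g" x ?y] mul_graded[of "inv g" g ?y x]
      mul_nonzero[of g "inv g" x ?y] mul_nonzero[of "inv g" g ?y x] g x y
    by (auto simp: r_inv l_inv)
  then obtain s t where s: "s \<noteq> 0" "x * ?y = s *\<^sub>R 1" and t: "t \<noteq> 0" "?y * x = t *\<^sub>R 1"
    using unit by blast
  define u where "u = (1 / s) *\<^sub>R ?y"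
  define v where "v = (1 / t) *\<^sub>R ?y"
  have uv: "x * u = 1" "v * x = 1"
    using s t by (simp_all add: u_def v_def)
  have "v = v * (x * u)" using uv by simp
  also have "\<dots> = (v * x) * u" by (rule mult.assoc[symmetric])
  also have "\<dots> = u" using uv by simp
  finally show ?thesis using uv by blast
qed

definition hom_inverse :: "'g \<Rightarrow> 'w" where
  "hom_inverse g = (SOME y. hom_basis g * y = 1 \<and> y * hom_basis g = 1)"

lemma hom_inverse:
  assumes "g \<in> carrier G"
  shows "hom_basis g * hom_inverse g = 1" "hom_inverse g * hom_basis g = 1"
proof -
  have "hom_basis g * hom_inverse g = 1 \<and> hom_inverse g * hom_basis g = 1"
    unfolding hom_inverse_def using invertible_component[OF assms hom_basis(3)[OF assms] hom_basis(1)[OF assms]]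
    by (rule someI_ex)
  then show "hom_basis g * hom_inverse g = 1" "hom_inverse g * hom_basis g = 1" by auto
qed

text \<open>The sum of the conjugates of \<open>p\<close> by the homogeneous basis, without the
  factor 1/|G|. For linear \<open>p\<close> it does not depend on the scaling of the basis
  vectors.\<close>

definition average :: "('w \<Rightarrow> 'w) \<Rightarrow> 'w \<Rightarrow> 'w" where
  "average p x = (\<Sum>g\<in>carrier G. hom_basis g * p (hom_inverse g * x))"

lemma linear_average: "linear p \<Longrightarrow> linear (average p)"
  unfolding average_def
  by (rule linearI)
    (simp_all add: distrib_left linear_add linear_cmul sum.distrib scaleR_sum_right)

text \<open>Reindex the sum along \<open>k \<mapsto> h \<otimes> k\<close>. The basis is
  multiplicative only up to scalars, but these cancel between basis vectors and inverses.\<close>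

lemma average_hom_basis:
  assumes p: "linear p" and h: "h \<in> carrier G"
  shows "average p (hom_basis h * x) = hom_basis h * average p x"
proof -
  \<comment> \<open>If \<open>hom_basis h * hom_basis k\<close> is \<open>s\<close> times
    \<open>hom_basis (h \<otimes> k)\<close>, then the inner factor produces \<open>s\<close>, and
    linearity of \<open>p\<close> moves it to the outer one.\<close>
  have eq: "hom_basis (h \<otimes> k) * p (hom_inverse (h \<otimes> k) * (hom_basis h * x)) =
      hom_basis h * (hom_basis k * p (hom_inverse k * x))" if k: "k \<in> carrier G" for k
  proof -
    have hk: "h \<otimes> k \<in> carrier G" using h k by simp
    have "hom_basis h * hom_basis k \<in> span {hom_basis (h \<otimes> k)}"
      using mul_graded[OF h k hom_basis(3)[OF h] hom_basis(3)[OF k]] hom_basis(2)[OF hk] by simp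
    then obtain s where s: "hom_basis h * hom_basis k = s *\<^sub>R hom_basis (h \<otimes> k)"
      unfolding span_singleton by blast
    have "hom_inverse (h \<otimes> k) * hom_basis h
        = hom_inverse (h \<otimes> k) * (hom_basis h * hom_basis k) * hom_inverse k"
      using hom_inverse(1)[OF k] by (simp add: mult.assoc)
    also have "\<dots> = s *\<^sub>R hom_inverse k"
      using hom_inverse(2)[OF hk] by (simp add: s)
    finally have "hom_inverse (h \<otimes> k) * (hom_basis h * x) = s *\<^sub>R (hom_inverse k * x)"
      by (simp flip: mult.assoc)
    then show ?thesis
      using s by (simp add: linear_cmul[OF p] flip: mult.assoc)
  qed
  have "bij_betw ((\<otimes>) h) (carrier G) (carrier G)"
  proof (rule bij_betwI[where g = "(\<otimes>) (inv h)"])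
    show "inv h \<otimes> (h \<otimes> k) = k" "h \<otimes> (inv h \<otimes> k) = k" if "k \<in> carrier G" for k
      using that h by (simp_all flip: m_assoc)
  qed (use h in auto)
  then have "average p (hom_basis h * x) = (\<Sum>k\<in>carrier G.
      hom_basis (h \<otimes> k) * p (hom_inverse (h \<otimes> k) * (hom_basis h * x)))"
    unfolding average_def by (rule sum.reindex_bij_betw[symmetric])
  also have "\<dots> = hom_basis h * average p x"
    unfolding average_def by (simp add: eq sum_distrib_left)
  finally show ?thesis .
qed

lemma average_mult:
  assumes p: "linear p"
  shows "average p (a * x) = a * average p x"
proof -
  have "a \<in> span (hom_basis ` carrier G)" by (simp add: span_hom_basis)
  then show ?thesis
  proof (induction rule: span_induct_alt)
    case base
    show ?case using linear_0[OF linear_average[OF p]] by simp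
  next
    case (step r w a)
    then show ?case
      using average_hom_basis[OF p] linear_add[OF linear_average[OF p]]
        linear_cmul[OF linear_average[OF p]]
      by (auto simp: distrib_right)
  qed
qed

text \<open>For a linear projection \<open>p\<close> onto \<open>I\<close>, \<open>average p\<close>
  commutes with left multiplication, has values in \<open>I\<close> and acts on \<open>I\<close> as
  multiplication by the order of the group. Its kernel is therefore a complementary left
  ideal.\<close>

theorem maschke:
  assumes I: "left_ideal I"
  shows "\<exists>J. left_ideal J \<and> I \<inter> J = {0} \<and> (\<forall>x::'w. \<exists>y\<in>I. \<exists>z\<in>J. x = y + z)"
proof -
  note sub = left_ideal_subspace[OF I]
  obtain p where p: "linear p" "\<And>x. p x \<in> I" "\<And>x. x \<in> I \<Longrightarrow> p x = x"
  proof -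
    obtain X where X: "X \<subseteq> I" "independent X" "I \<subseteq> span X"
      using basis_exists[of I] by metis
    obtain p where p: "linear p" "\<forall>x\<in>X. p x = x" "range p = span ((\<lambda>x. x) ` X)"
      using linear_independent_extend_subspace[OF X(2), of "\<lambda>x. x"] by blast
    have I: "span X = I" using X sub span_minimal by blast
    have "p x = x" if "x \<in> I" for x
      using linear_eq_on[OF p(1) linear_id] p(2) that unfolding I[symmetric] by simp
    moreover have "p x \<in> I" for x
      using p(3) I by auto
    ultimately show thesis using that p(1) by blast
  qed
  note lin = linear_average[OF p(1)]
  let ?n = "real (card (carrier G))"
  have n: "?n \<noteq> 0" using finite_group one_closed by auto
  have into: "average p x \<in> I" for x
    unfolding average_def using p(2) by (intro subspace_sum[OF sub] left_idealD[OF I])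
  have on: "average p x = ?n *\<^sub>R x" if "x \<in> I" for x
  proof -
    have "hom_basis g * p (hom_inverse g * x) = x" if "g \<in> carrier G" for g
      using p(3)[OF left_idealD[OF I \<open>x \<in> I\<close>]] hom_inverse(1)[OF that]
      by (simp flip: mult.assoc)
    then show ?thesis by (simp add: average_def scaleR_conv_of_real)
  qed
  let ?J = "{x. average p x = 0}"
  have "left_ideal ?J"
    unfolding left_ideal_def by (auto simp: average_mult[OF p(1)] intro: linear_subspace_kernel lin)
  moreover have "I \<inter> ?J = {0}"
    using on n subspace_0[OF sub] linear_0[OF lin] by auto
  moreover have "\<exists>y\<in>I. \<exists>z\<in>?J. x = y + z" for x
  proof (intro bexI)
    let ?y = "(1 / ?n) *\<^sub>R average p x"
    show "x = ?y + (x - ?y)" by simp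
    show "?y \<in> I" using into sub by (simp add: subspace_scale)
    show "x - ?y \<in> ?J"
      using on[OF into, of x] n by (simp add: linear_diff[OF lin] linear_cmul[OF lin])
  qed
  ultimately show ?thesis by blast
qed

sublocale semisimple_real_algebra "hom_basis ` carrier G"
  by unfold_locales (simp_all add: finite_group span_hom_basis maschke)

end

section \<open>Endomorphisms of minimal left ideals\<close>

text \<open>Primitivity gives some \<open>z\<close> with \<open>z * x = e\<close>, and
  \<open>e * z * e\<close> is then a left inverse of \<open>x\<close> inside the corner.\<close>

lemma corner_division_subalgebra:
  fixes e :: "'a::real_algebra_1"
  assumes e: "primitive_idempotent e" and fin: "finite B" "span B = (UNIV :: 'a set)"
  shows "real_division_subalgebra {x. e * x = x \<and> x * e = x} e"
proof
  have idem: "e * e = e" and nz: "e \<noteq> 0"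
    and inv: "\<And>y. \<lbrakk>y * e = y; y \<noteq> 0\<rbrakk> \<Longrightarrow> \<exists>z. z * y = e"
    using e by (auto simp: primitive_idempotent_def)
  show "subspace {x. e * x = x \<and> x * e = x}"
    by (auto simp: subspace_def distrib_left distrib_right)
  show "x * y \<in> {x. e * x = x \<and> x * e = x}"
    if "x \<in> {x. e * x = x \<and> x * e = x}" "y \<in> {x. e * x = x \<and> x * e = x}" for x y
    using that by (simp add: mult.assoc) (simp flip: mult.assoc)
  show "e \<in> {x. e * x = x \<and> x * e = x}" "e \<noteq> 0" using idem nz by auto
  show "\<exists>y\<in>{x. e * x = x \<and> x * e = x}. y * x = e"
    if x: "x \<in> {x. e * x = x \<and> x * e = x}" "x \<noteq> 0" for x
  proof -
    obtain z where z: "z * x = e" using inv x by blast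
    have "e * z * e * x = e * (z * (e * x))" by (simp add: mult.assoc)
    also have "\<dots> = e" using x z idem by simp
    finally have "e * z * e * x = e" .
    moreover have "e * (e * z * e) = e * z * e"
      using idem by (simp flip: mult.assoc)
    moreover have "e * z * e * e = e * z * e"
      using idem by (simp add: mult.assoc)
    ultimately show ?thesis by blast
  qed
  show "\<exists>B. finite B \<and> {x. e * x = x \<and> x * e = x} \<subseteq> span B" using fin by auto
qed simp_all

section \<open>Minimal left ideals as left spaces over real, complex or quaternion scalars\<close>

text \<open>The final theorem fixes \<open>nat \<Rightarrow> quat\<close> as the type of vectors,
  and basis coordinates inject the algebra into it. The enumeration may repeat elements of
  \<open>B\<close>; for injectivity it suffices that each one occurs.\<close>

definition coordinates :: "'a::real_vector set \<Rightarrow> 'a \<Rightarrow> nat \<Rightarrow> quat" where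
  "coordinates B x n = of_real (representation B x (from_nat_into B n))"

lemma inj_coordinates:
  assumes "independent B" "span B = UNIV" "countable B"
  shows "inj (coordinates B)"
proof (rule injI)
  fix x y assume eq: "coordinates B x = coordinates B y"
  have "representation B x b = representation B y b" for b
  proof (cases "b \<in> B")
    case True
    then obtain n where "from_nat_into B n = b"
      using from_nat_into_surj[OF assms(3)] by blast
    with fun_cong[OF eq, of n] show ?thesis
      by (simp add: coordinates_def)
  next
    case False
    then show ?thesis using representation_ne_zero by metis
  qed
  then have "representation B x = representation B y" by blast
  then show "x = y"
    using real_vector.sum_nonzero_representation_eq[OF assms(1)] assms(2) by (metis UNIV_I)
qed

text \<open>The right \<open>eAe\<close>-space \<open>Ae\<close> as a left space over quaternions, along an antihomomorphism
  \<open>\<psi>\<close> to \<open>eAe\<close>; \<open>emb\<close> only moves the carrier to the prescribed type. The ring part of the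
  record is irrelevant.\<close>

definition corner_module ::
    "('a \<Rightarrow> 'b) \<Rightarrow> 'a::real_algebra \<Rightarrow> (quat \<Rightarrow> 'a) \<Rightarrow> (quat, 'b) module" where
  "corner_module emb e \<psi> =
    \<lparr>carrier = emb ` {x. x * e = x}, mult = (\<lambda>u v. u), one = emb 0, zero = emb 0,
     add = (\<lambda>u v. emb (the_inv emb u + the_inv emb v)), smult = (\<lambda>d u. emb (the_inv emb u * \<psi> d))\<rparr>"

lemma of_real_in_quat_subfield:
  "K \<in> {range of_real, range quat_of_complex, UNIV} \<Longrightarrow> of_real a \<in> K"
  by (auto simp flip: quat_of_complex_of_real)

lemma ring_on_quat_subfield:
  "K \<in> {range of_real, range quat_of_complex, UNIV} \<Longrightarrow> ring_on K \<in> {R_ring, C_ring, H_ring}"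
  by (auto simp: R_ring_def C_ring_def H_ring_def)

lemma skew_field_quat_subfield:
  "K \<in> {range of_real, range quat_of_complex, UNIV} \<Longrightarrow> skew_field (ring_on K)"
  using skew_field_R_ring skew_field_C_ring skew_field_H_ring
  by (auto simp: R_ring_def C_ring_def H_ring_def)

locale corner =
  fixes emb :: "'a::real_algebra_1 \<Rightarrow> 'b" and e :: 'a and \<psi> :: "quat \<Rightarrow> 'a" and K :: "quat set"
  assumes inj_emb: "inj emb" and idem: "e * e = e"
    and K: "K \<in> {range of_real, range quat_of_complex, UNIV}"
    and linear_psi: "linear \<psi>" and psi_one: "\<psi> 1 = e"
    and psi_mult: "\<lbrakk>x \<in> K; y \<in> K\<rbrakk> \<Longrightarrow> \<psi> (x * y) = \<psi> y * \<psi> x"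
    and psi_image: "\<psi> ` K = {x. e * x = x \<and> x * e = x}"
begin

abbreviation "V \<equiv> corner_module emb e \<psi>"

lemma the_inv_emb [simp]: "the_inv emb (emb x) = x"
  by (rule the_inv_f_f[OF inj_emb])

lemma emb_eq [simp]: "emb x = emb y \<longleftrightarrow> x = y"
  by (rule inj_eq[OF inj_emb])

lemma psi_of_real: "\<psi> (of_real a) = a *\<^sub>R e"
  by (simp add: of_real_def linear_cmul[OF linear_psi] psi_one)

lemma psi_unit: "d \<in> K \<Longrightarrow> \<psi> d * e = \<psi> d"
  using psi_image by blast

lemma V_abelian_group: "abelian_group V"
proof (rule abelian_groupI)
  fix x assume "x \<in> carrier V"
  then obtain v where v: "x = emb v" "v * e = v" by (auto simp: corner_module_def)
  then show "\<exists>y\<in>carrier V. y \<oplus>\<^bsub>V\<^esub> x = \<zero>\<^bsub>V\<^esub>"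
    by (intro bexI[of _ "emb (- v)"]) (auto simp: corner_module_def)
qed (auto simp: corner_module_def algebra_simps)

text \<open>Scalars act by right multiplication with \<open>\<psi> d\<close>; since
  \<open>\<psi>\<close> reverses products, this is a left action.\<close>

lemma V_vector_space: "left_vector_space (ring_on K) V"
proof (intro left_vector_space.intro left_vector_space_axioms.intro)
  show "skew_field (ring_on K)" by (rule skew_field_quat_subfield[OF K])
  show "abelian_group V" by (rule V_abelian_group)
qed (auto simp: corner_module_def ring_on_def mult.assoc psi_unit psi_mult psi_one
    linear_add[OF linear_psi] algebra_simps)

lemma V_ops [simp]:
  "emb v \<oplus>\<^bsub>V\<^esub> emb w = emb (v + w)" "d \<odot>\<^bsub>V\<^esub> emb v = emb (v * \<psi> d)" "\<zero>\<^bsub>V\<^esub> = emb 0"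
  by (simp_all add: corner_module_def)

lemma finsum_V:
  assumes "finite X" "f \<in> X \<rightarrow> carrier V"
  shows "(\<Oplus>\<^bsub>V\<^esub>x\<in>X. f x) = emb (\<Sum>x\<in>X. the_inv emb (f x))"
proof -
  interpret abelian_group V by (rule V_abelian_group)
  show ?thesis using assms
  proof (induction X)
    case empty
    then show ?case by simp
  next
    case (insert x X)
    then have "(\<Oplus>\<^bsub>V\<^esub>x\<in>insert x X. f x) = f x \<oplus>\<^bsub>V\<^esub> (\<Oplus>\<^bsub>V\<^esub>x\<in>X. f x)"
      by (intro finsum_insert) auto
    then show ?case using insert by (simp add: corner_module_def)
  qed
qed

text \<open>Multiplying a spanning set by \<open>e\<close> on the right spans Ae over the reals, and
  real coefficients are available in every \<open>K\<close> through \<open>of_real\<close>.\<close>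

lemma V_fin_dim:
  assumes "finite B" "span B = (UNIV :: 'a set)"
  shows "fin_dim_vector_space (ring_on K) V"
proof (intro fin_dim_vector_space.intro fin_dim_vector_space_axioms.intro V_vector_space)
  let ?C = "(\<lambda>b. b * e) ` B"
  have fin: "finite ?C" using assms by simp
  have C: "b * e = b" if "b \<in> ?C" for b
    using that idem by (auto simp: mult.assoc)
  have "\<exists>c\<in>emb ` ?C \<rightarrow> carrier (ring_on K).
      v = (\<Oplus>\<^bsub>V\<^esub>b\<in>emb ` ?C. c b \<odot>\<^bsub>V\<^esub> b)" if v: "v \<in> carrier V" for v
  proof -
    obtain x where x: "v = emb x" "x * e = x" using v by (auto simp: corner_module_def)
    have "x \<in> span ?C"
    proof -
      have "x \<in> span B" using assms by simp
      then have "x * e \<in> span ?C"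
        by (subst linear_span_image) (auto intro!: linearI simp: distrib_right)
      then show ?thesis using x by simp
    qed
    then obtain c where c: "x = (\<Sum>b\<in>?C. c b *\<^sub>R b)"
      using span_finite[OF fin] by auto
    define d where "d u = (of_real (c (the_inv emb u)) :: quat)" for u
    have d: "d \<in> emb ` ?C \<rightarrow> carrier (ring_on K)"
      using of_real_in_quat_subfield[OF K] by (auto simp: d_def ring_on_def)
    have smult: "d (emb b) \<odot>\<^bsub>V\<^esub> emb b = emb (c b *\<^sub>R b)" if "b \<in> ?C" for b
      using C[OF that] by (simp add: d_def psi_of_real)
    have "(\<Oplus>\<^bsub>V\<^esub>u\<in>emb ` ?C. d u \<odot>\<^bsub>V\<^esub> u) = emb (\<Sum>u\<in>emb ` ?C. the_inv emb (d u \<odot>\<^bsub>V\<^esub> u))"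
    proof (rule finsum_V)
      show "(\<lambda>u. d u \<odot>\<^bsub>V\<^esub> u) \<in> emb ` ?C \<rightarrow> carrier V"
      proof
        fix u assume "u \<in> emb ` ?C"
        then obtain b where b: "b \<in> ?C" "u = emb b" by blast
        have "emb (c b *\<^sub>R b) \<in> carrier V"
          using C[OF b(1)] by (simp add: corner_module_def)
        then show "d u \<odot>\<^bsub>V\<^esub> u \<in> carrier V" unfolding b(2) smult[OF b(1)] .
      qed
    qed (use fin in simp)
    also have "(\<Sum>u\<in>emb ` ?C. the_inv emb (d u \<odot>\<^bsub>V\<^esub> u)) = (\<Sum>b\<in>?C. the_inv emb (d (emb b) \<odot>\<^bsub>V\<^esub> emb b))"
      by (rule sum.reindex[unfolded o_def]) (rule inj_on_subset[OF inj_emb subset_UNIV])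
    also have "\<dots> = (\<Sum>b\<in>?C. c b *\<^sub>R b)"
      by (rule sum.cong[OF refl]) (simp only: smult the_inv_emb)
    finally have "v = (\<Oplus>\<^bsub>V\<^esub>u\<in>emb ` ?C. d u \<odot>\<^bsub>V\<^esub> u)"
      unfolding x(1) c by (rule sym)
    then show ?thesis using d by (rule bexI)
  qed
  then show "\<exists>B. finite B \<and> B \<subseteq> carrier V \<and>
      (\<forall>v\<in>carrier V. \<exists>c\<in>B \<rightarrow> carrier (ring_on K). v = (\<Oplus>\<^bsub>V\<^esub>b\<in>B. c b \<odot>\<^bsub>V\<^esub> b))"
  proof (intro exI[of _ "emb ` ?C"] conjI ballI)
    show "finite (emb ` ?C)" using fin by (rule finite_imageI)
    show "emb ` ?C \<subseteq> carrier V"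
    proof
      fix u assume "u \<in> emb ` ?C"
      then obtain b where b: "b \<in> ?C" "u = emb b" by blast
      show "u \<in> carrier V" using b(2) C[OF b(1)] by (simp add: corner_module_def)
    qed
  qed
qed

definition left_action :: "'a \<Rightarrow> 'b \<Rightarrow> 'b" where
  "left_action a = (\<lambda>u\<in>carrier V. emb (a * the_inv emb u))"

lemma left_action_emb: "v * e = v \<Longrightarrow> left_action a (emb v) = emb (a * v)"
  by (simp add: left_action_def corner_module_def)

lemma left_action_extensional: "left_action a \<in> extensional (carrier V)"
  by (simp add: left_action_def)

lemma carrier_V_cases:
  assumes "u \<in> carrier V"
  obtains v where "u = emb v" "v * e = v"
  using assms by (auto simp: corner_module_def)

lemma emb_in_carrier [simp]: "emb v \<in> carrier V \<longleftrightarrow> v * e = v"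
  by (auto simp: corner_module_def)

lemma left_action_End: "left_action a \<in> carrier (End_algebra (ring_on K) V)"
  unfolding End_algebra_def
  by (auto simp: left_action_emb left_action_extensional ring_on_def mult.assoc psi_unit distrib_left
      distrib_right PiE_iff elim!: carrier_V_cases)

lemma left_action_eqI:
  assumes "f \<in> extensional (carrier V)" "\<And>v. v * e = v \<Longrightarrow> f (emb v) = emb (a * v)"
  shows "left_action a = f"
  by (rule extensionalityI[OF left_action_extensional assms(1)])
    (auto simp: left_action_emb assms(2) elim!: carrier_V_cases)

lemma left_action_hom:
  "left_action (a * b) = left_action a \<otimes>\<^bsub>End_algebra (ring_on K) V\<^esub> left_action b"
  "left_action (a + b) = left_action a \<oplus>\<^bsub>End_algebra (ring_on K) V\<^esub> left_action b"
  "left_action 1 = \<one>\<^bsub>End_algebra (ring_on K) V\<^esub>"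
  "left_action (r *\<^sub>R a) = r \<odot>\<^bsub>End_algebra (ring_on K) V\<^esub> left_action a"
  by (rule left_action_eqI;
      simp add: End_algebra_def compose_def left_action_emb mult.assoc distrib_right psi_of_real)+

text \<open>Pulls an endomorphism back along \<open>emb\<close> to a map on Ae with the properties
  that \<open>double_centraliser\<close> demands. Linearity over eAe comes from the fact that
  \<open>\<psi>\<close> maps \<open>K\<close> onto eAe.\<close>

lemma End_D:
  assumes g: "g \<in> carrier (End_algebra (ring_on K) V)"
  defines "f \<equiv> \<lambda>v. the_inv emb (g (emb v))"
  shows "v * e = v \<Longrightarrow> g (emb v) = emb (f v)" "v * e = v \<Longrightarrow> f v * e = f v"
    "\<lbrakk>v * e = v; w * e = w\<rbrakk> \<Longrightarrow> f (v + w) = f v + f w"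
    "\<lbrakk>v * e = v; e * d = d; d * e = d\<rbrakk> \<Longrightarrow> f (v * d) = f v * d"
proof -
  have g_emb: "g (emb v) = emb (f v) \<and> f v * e = f v" if "v * e = v" for v
  proof -
    have "g (emb v) \<in> carrier V" using g that by (auto simp: End_algebra_def PiE_iff)
    then show ?thesis by (auto simp: f_def elim!: carrier_V_cases)
  qed
  then show "v * e = v \<Longrightarrow> g (emb v) = emb (f v)" "v * e = v \<Longrightarrow> f v * e = f v" by auto
  show "f (v + w) = f v + f w" if vw: "v * e = v" "w * e = w"
  proof -
    have "g (emb v \<oplus>\<^bsub>V\<^esub> emb w) = g (emb v) \<oplus>\<^bsub>V\<^esub> g (emb w)"
      using g vw by (auto simp: End_algebra_def simp del: V_ops)
    then show ?thesis using vw g_emb by (simp add: distrib_right)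
  qed
  show "f (v * d) = f v * d" if vd: "v * e = v" "e * d = d" "d * e = d"
  proof -
    obtain k where k: "k \<in> K" "d = \<psi> k" using psi_image vd by blast
    have "g (k \<odot>\<^bsub>V\<^esub> emb v) = k \<odot>\<^bsub>V\<^esub> g (emb v)"
      using g vd(1) k(1) by (auto simp: End_algebra_def ring_on_def simp del: V_ops)
    then show ?thesis using vd g_emb k by (simp add: mult.assoc)
  qed
qed

end

section \<open>The isomorphism onto the direct sum\<close>

theorem theorem3:
  fixes G :: "('g, 'm) monoid_scheme"
    and W :: "'g \<Rightarrow> 'w::real_algebra_1 set"
  assumes "group G"
    and "finite (carrier G)"
    and "graded_twisted_algebra G W (*) 1"
  shows "\<exists>(r::nat) (D :: nat \<Rightarrow> quat ring) (V :: nat \<Rightarrow> (quat, nat \<Rightarrow> quat) module).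
    (\<forall>i<r. D i \<in> {R_ring, C_ring, H_ring} \<and> fin_dim_vector_space (D i) (V i)) \<and>
    real_algebra_iso (type_algebra :: (real, 'w) module)
      (algebra_direct_sum r (\<lambda>i. End_algebra (D i) (V i))) \<noteq> {}"
proof -
  interpret finite_graded_twisted_algebra G W
    by (intro finite_graded_twisted_algebra.intro finite_graded_twisted_algebra_axioms.intro assms)
  obtain F :: "'w set" where F: "orthogonal_primitive_family F" "ideal_generated F = UNIV"
    by (rule complete_orthogonal_family_exists)
  then have finF: "finite F" and prim: "\<And>e. e \<in> F \<Longrightarrow> primitive_idempotent e"
    by (auto simp: orthogonal_primitive_family_def)
  obtain X :: "'w set" where X: "independent X" "UNIV \<subseteq> span X"
    using basis_exists[of UNIV] by metis
  then have spanX: "finite X" "span X = UNIV"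
    using finite_independent(1)[OF X(1)] by auto
  define emb :: "'w \<Rightarrow> nat \<Rightarrow> quat" where "emb = coordinates X"
  have emb: "inj emb"
    unfolding emb_def using X(1) spanX by (intro inj_coordinates countable_finite)
  have "\<exists>K \<psi>. corner emb e \<psi> K" if e: "e \<in> F" for e
  proof -
    interpret real_division_subalgebra "{x. e * x = x \<and> x * e = x}" e
      by (rule corner_division_subalgebra[OF prim[OF e] spanX])
    obtain K \<psi> where "K \<in> {range of_real, range quat_of_complex, UNIV}" "linear \<psi>" "\<psi> 1 = e"
      "\<And>x y. \<lbrakk>x \<in> K; y \<in> K\<rbrakk> \<Longrightarrow> \<psi> (x * y) = \<psi> y * \<psi> x"
      "\<psi> ` K = {x. e * x = x \<and> x * e = x}"
      using frobenius by blast
    moreover have "e * e = e" using prim[OF e] by (simp add: primitive_idempotent_def)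
    ultimately have "corner emb e \<psi> K" using emb by (intro corner.intro)
    then show ?thesis by blast
  qed
  then obtain K \<psi> where corner: "\<And>e. e \<in> F \<Longrightarrow> corner emb e (\<psi> e) (K e)"
    by metis
  \<comment> \<open>There is one summand for each idempotent of the family, and \<open>h\<close>
    numbers them.\<close>
  define r where "r = card F"
  obtain h where h: "bij_betw h {..<r} F"
    using ex_bij_betw_nat_finite[OF finF] by (auto simp: r_def atLeast0LessThan)
  have hF: "h i \<in> F" if "i < r" for i
    using h that by (auto simp: bij_betw_def)
  define D where "D i = ring_on (K (h i))" for i
  define V where "V i = corner_module emb (h i) (\<psi> (h i))" for i
  \<comment> \<open>An element acts by left multiplication on all the ideals We
    simultaneously.\<close>
  define \<Phi> where "\<Phi> a = (\<lambda>i\<in>{..<r}. corner.left_action emb (h i) (\<psi> (h i)) a)" for a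
  have c: "corner emb (h i) (\<psi> (h i)) (K (h i))" if "i < r" for i
    using corner hF that by blast
  have good: "D i \<in> {R_ring, C_ring, H_ring} \<and> fin_dim_vector_space (D i) (V i)" if "i < r" for i
    unfolding D_def V_def
    using ring_on_quat_subfield[OF corner.K[OF c[OF that]]] corner.V_fin_dim[OF c[OF that] spanX]
    by blast
  let ?S = "algebra_direct_sum r (\<lambda>i. End_algebra (D i) (V i))"
  have closed: "\<Phi> a \<in> carrier ?S" for a
    unfolding algebra_direct_sum_def \<Phi>_def D_def V_def
    by (simp add: restrict_PiE_iff corner.left_action_End[OF c])
  note \<Phi>_hom = \<Phi>_def algebra_direct_sum_def D_def V_def corner.left_action_hom[OF c]
  have hom: "\<Phi> \<in> ring_hom (type_algebra :: (real, 'w) module) ?S"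
  proof (rule ring_hom_memI)
    show "\<Phi> a \<in> carrier ?S" for a by (rule closed)
    show "\<Phi> (a \<otimes>\<^bsub>type_algebra\<^esub> b) = \<Phi> a \<otimes>\<^bsub>?S\<^esub> \<Phi> b"
      "\<Phi> (a \<oplus>\<^bsub>type_algebra\<^esub> b) = \<Phi> a \<oplus>\<^bsub>?S\<^esub> \<Phi> b" for a b
      by (simp_all add: \<Phi>_hom type_algebra_def cong: restrict_cong)
    show "\<Phi> \<one>\<^bsub>type_algebra\<^esub> = \<one>\<^bsub>?S\<^esub>"
      by (simp add: \<Phi>_hom type_algebra_def cong: restrict_cong)
  qed
  have inj: "inj \<Phi>"
  proof (rule injI)
    fix a b assume eq: "\<Phi> a = \<Phi> b"
    have "a - b = 0"
    proof (rule faithful[OF F(2)])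
      fix e v assume e: "e \<in> F" and v: "v * e = v"
      obtain i where i: "i < r" "h i = e" using h e by (auto simp: bij_betw_def)
      have act: "corner.left_action emb e (\<psi> e) x (emb v) = emb (x * v)" for x
        using corner.left_action_emb[OF corner[OF e] v] .
      have "corner.left_action emb e (\<psi> e) a = corner.left_action emb e (\<psi> e) b"
        using fun_cong[OF eq, of i] i by (simp add: \<Phi>_def)
      then have "emb (a * v) = emb (b * v)"
        by (simp only: act[symmetric])
      then have "a * v = b * v" by (rule injD[OF emb])
      then show "(a - b) * v = 0" by (simp add: left_diff_distrib)
    next
      show "e * e = e" if "e \<in> F" for e
        using prim[OF that] by (simp add: primitive_idempotent_def)
    qed
    then show "a = b" by simp
  qed
  have surj: "g \<in> range \<Phi>" if g: "g \<in> carrier ?S" for g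
  proof -
    \<comment> \<open>\<open>k\<close> inverts the numbering, so that the components of
      \<open>g\<close> can be indexed by idempotents as in
      \<open>double_centraliser\<close>.\<close>
    define k where "k = the_inv_into {..<r} h"
    have k: "k e < r" "h (k e) = e" if "e \<in> F" for e
    proof -
      show "h (k e) = e"
        unfolding k_def by (rule f_the_inv_into_f_bij_betw[OF h that])
      have "e \<in> h ` {..<r}" using h that by (simp add: bij_betw_def)
      then have "k e \<in> {..<r}"
        unfolding k_def by (rule the_inv_into_into[OF bij_betw_imp_inj_on[OF h] _ subset_refl])
      then show "k e < r" by simp
    qed
    have gE: "g i \<in> carrier (End_algebra (D i) (V i))" if "i < r" for i
      using g that by (auto simp: algebra_direct_sum_def PiE_iff)
    have gE': "g (k e) \<in> carrier (End_algebra (ring_on (K e)) (corner_module emb e (\<psi> e)))"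
      if "e \<in> F" for e
      using gE[OF k(1)[OF that]] k(2)[OF that] by (simp add: D_def V_def)
    define f where "f e v = the_inv emb (g (k e) (emb v))" for e v
    note End_D = corner.End_D[OF corner gE', folded f_def]
    have "\<exists>a. \<forall>e\<in>F. \<forall>v. v * e = v \<longrightarrow> f e v = a * v"
    proof (rule double_centraliser[OF F, of f])
      show "f e v * e = f e v" if "e \<in> F" "v * e = v" for e v
        using End_D(2)[OF that(1,1,2)] .
      show "f e (v + w) = f e v + f e w" if "e \<in> F" "v * e = v" "w * e = w" for e v w
        using End_D(3)[OF that(1,1,2,3)] .
      show "f e (v * d) = f e v * d" if "e \<in> F" "v * e = v" "e * d = d" "d * e = d" for e v d
        using End_D(4)[OF that(1,1,2,3,4)] .
    qed blast
    then obtain a where a: "\<And>e v. \<lbrakk>e \<in> F; v * e = v\<rbrakk> \<Longrightarrow> f e v = a * v"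
      by blast
    have "corner.left_action emb (h i) (\<psi> (h i)) a = g i" if i: "i < r" for i
    proof (rule corner.left_action_eqI[OF c[OF i]])
      show "g i \<in> extensional (carrier (corner_module emb (h i) (\<psi> (h i))))"
        using gE[OF i] by (auto simp: End_algebra_def V_def PiE_iff)
      fix v assume v: "v * h i = v"
      have ki: "k (h i) = i"
        unfolding k_def using h i by (intro the_inv_into_f_f) (auto simp: bij_betw_def)
      show "g i (emb v) = emb (a * v)"
        using End_D(1)[OF hF[OF i] hF[OF i] v] a[OF hF[OF i] v] by (simp add: ki)
    qed
    moreover have "g \<in> extensional {..<r}"
      using g by (simp add: algebra_direct_sum_def PiE_iff)
    ultimately have "\<Phi> a = g"
      by (intro extensionalityI[of _ "{..<r}"]) (simp_all add: \<Phi>_def)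
    then show ?thesis by blast
  qed
  have "range \<Phi> = carrier ?S"
    using closed surj by blast
  then have "bij_betw \<Phi> (carrier (type_algebra :: (real, 'w) module)) (carrier ?S)"
    using inj by (simp add: bij_betw_def type_algebra_def)
  moreover have "\<Phi> (s *\<^sub>R a) = s \<odot>\<^bsub>?S\<^esub> \<Phi> a" for s a
    by (simp add: \<Phi>_hom cong: restrict_cong)
  ultimately have "\<Phi> \<in> real_algebra_iso (type_algebra :: (real, 'w) module) ?S"
    using hom by (simp add: real_algebra_iso_def ring_iso_def type_algebra_def)
  with good show ?thesis by blast
qed

end
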